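(* Let $\{Q_n\}_{n\ge0}$ and $\{\overline G_n\}_{n\ge0}$ satisfy Assumptions A and B of the context, and let the operators $T_n$ defined by $$(T_nu)(x)=-\int_{y\in\mathbb{R}}\overline G_n(y,x-y)\,dQ_n(u(y)),\qquad u\in\mathcal{D},\ x\in\mathbb{R},$$ satisfy Assumption C of the context. Let $\{F_n\}_{n\ge0}$ be the distribution functions with $F_0(x)=\mathbf 1_{\{x\ge0\}}$ and $\overline F_{n+1}=T_n\overline F_n$ for all $n\ge0$, where $\overline F_n=1-F_n$. Then the sequence of distribution functions $\{F_n^s\}_{n\ge0}$, where $F_n^s(x)=F_n(x+\mathrm{Med}(F_n))$, is tight.
   Context: $\mathcal{D}$ is the set of functions $\overline F:\mathbb{R}\to[0,1]$ such that $1-\overline F$ is a distribution function (nondecreasing, right-continuous, limits $0$ at $-\infty$ and $1$ at $+\infty$). $\mathrm{Med}(F)=\inf\{x:F(x)\ge1/2\}$. A sequence of distribution functions $H_n$ is tight if for every $\varepsilon>0$ there is $A_\varepsilon>0$ with $H_n(A_\varepsilon)-H_n(-A_\varepsilon)>1-\varepsilon$ for all $n$. $\{Q_n\}$ is a sequence of increasing, nonlinear functions mapping $[0,1]$ onto itself; for each $n$ and $y\in\mathbb{R}$, $\overline G_n(y,\cdot)\in\mathcal{D}$; $T_n$ maps $\mathcal D$ to $\mathcal D$. All constants below are independent of $n$, and all conditions hold for every $n$. Assumption A. $Q_n:[0,1]\to[0,1]$ is increasing with $Q_n(0)=0$, $Q_n(1)=1$. There exist $\delta_0>0$, $m\in(1,2]$,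 $c^*>0$, $\theta^*>0$ such that $Q_n(x)\ge mx$ for all $x\le2\delta_0$, and $$\frac{x_2}{x_1}\le\frac{Q_n(x_2)}{Q_n(x_1)}\bigl[1+c^*(Q_n(x_1))^{\theta^*}\bigr]\quad\text{for all }0<x_1<x_2\le2(\delta_0\wedge x_1).$$ Assumption B. (G1) For each $x$, $y\mapsto\overline G_n(y,x-y)$ is increasing and $y\mapsto\overline G_n(y,x)$ is decreasing (non-strictly). (G2) There exist $a\in(0,1)$ and $M_0>0$ such that $\overline G_n(y-M,x+M)\le e^{-aM}\overline G_n(y,x)$ for all $x\ge0$, $y\in\mathbb{R}$, $M\ge M_0$. (G3) With $m$ as in Assumption A and $\varepsilon_0=(\log m)/100$, $\overline G_n(y,0)\ge1-\varepsilon_0$ for all $y$. The class $\widetilde{\mathcal{Q}}$ is the collection of strictly increasing continuous functions $\tilde Q:[0,1]\to[0,1]$ with $\tilde Q(0)=0$, $\tilde Q(1)=1$ such that: (T1) $\tilde Q(x)>x$ for all $x\in(0,1)$, and for any $\delta>0$ there exists $c_\delta>1$ such that $\tilde Q(x)>c_\delta x$ for $0<x\le1-\delta$; (T2) for each $\delta\in(0,1)$ there exists a nonnegative function $g_\delta(\varepsilon)\to0$ as $\varepsilon\searrow0$ such that, if $x\ge\delta$ and $\tilde Q(x)\le(1-\delta)/(1+\varepsilon)$, then $\tilde Q((1+g_\delta(\varepsilon))x)\ge(1+\varepsilon)\tilde Q(x)$ (where $\tilde Q(z)$ is read as $1$ for $z>1$). Assumption C. There exists $\tilde Q\in\widetilde{\mathcal{Q}}$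 such that for each $\eta_1>0$ there exists $B=B(\eta_1)\ge0$ satisfying, for all $n$, $u\in\mathcal{D}$ and $x\in\mathbb{R}$, $(T_nu)(x)\ge\tilde Q(u(x+B))-\eta_1$ and $(T_nu)(x)\le\tilde Q(u(x-B))+\eta_1$. *)

theory Defs
  imports "HOL-Analysis.Analysis"
begin

definition distribution_function :: "(real \<Rightarrow> real) \<Rightarrow> bool" where
  "distribution_function F \<longleftrightarrow>
     mono F \<and> (\<forall>x. continuous (at_right x) F) \<and>
     (F \<longlongrightarrow> 0) at_bot \<and> (F \<longlongrightarrow> 1) at_top"

definition tail_functions :: "(real \<Rightarrow> real) set" where
  "tail_functions =
     {u. range u \<subseteq> {0..1} \<and> distribution_function (\<lambda>x. 1 - u x)}"

definition Med :: "(real \<Rightarrow> real) \<Rightarrow> real" where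
  "Med F = Inf {x. F x \<ge> 1/2}"

definition tight_dfs :: "(nat \<Rightarrow> real \<Rightarrow> real) \<Rightarrow> bool" where
  "tight_dfs H \<longleftrightarrow>
     (\<forall>n. distribution_function (H n)) \<and>
     (\<forall>\<epsilon>>0. \<exists>A>0. \<forall>n. H n A - H n (-A) > 1 - \<epsilon>)"

text \<open>
  The operator \<open>u \<mapsto> (x \<mapsto> -\<integral> G(y, x - y) dQ(u(y)))\<close>. Since \<open>Q \<circ> u\<close> is
  nonincreasing, the sign is absorbed into the integrator: we integrate against the
  Lebesgue-Stieltjes measure of the nondecreasing function \<open>y \<mapsto> - Q(u(y))\<close>. That function is
  right-continuous because an increasing \<open>Q\<close> mapping \<open>[0,1]\<close> onto itself is continuous.
\<close>
definition rec_op ::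
  "(real \<Rightarrow> real) \<Rightarrow> (real \<Rightarrow> real \<Rightarrow> real) \<Rightarrow> (real \<Rightarrow> real) \<Rightarrow> real \<Rightarrow> real" where
  "rec_op Q G u x = (\<integral>y. G y (x - y) \<partial>interval_measure (\<lambda>y. - Q (u y)))"

text \<open>
  Functions on \<open>[0,1]\<close> are represented by functions on the reals of which only the values on
  \<open>{0..1}\<close> are used. \<open>Increasing\<close> is non-strict unless strictness is stated. The constant \<open>m\<close>
  is a parameter because assumptions A and B share it.
\<close>
definition assumption_A :: "real \<Rightarrow> (nat \<Rightarrow> real \<Rightarrow> real) \<Rightarrow> bool" where
  "assumption_A m Q \<longleftrightarrow>
     1 < m \<and> m \<le> 2 \<and>
     (\<forall>n. Q n ` {0..1} \<subseteq> {0..1} \<and> mono_on {0..1} (Q n) \<and> Q n 0 = 0 \<and> Q n 1 = 1) \<and>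
     (\<exists>\<delta>\<^sub>0>0. \<exists>c>0. \<exists>\<theta>>0. \<forall>n.
        (\<forall>x\<in>{0..1}. x \<le> 2 * \<delta>\<^sub>0 \<longrightarrow> Q n x \<ge> m * x) \<and>
        (\<forall>x\<^sub>1\<in>{0..1}. \<forall>x\<^sub>2\<in>{0..1}.
           0 < x\<^sub>1 \<and> x\<^sub>1 < x\<^sub>2 \<and> x\<^sub>2 \<le> 2 * min \<delta>\<^sub>0 x\<^sub>1 \<longrightarrow>
           x\<^sub>2 / x\<^sub>1 \<le> Q n x\<^sub>2 / Q n x\<^sub>1 * (1 + c * (Q n x\<^sub>1) powr \<theta>)))"

definition assumption_B :: "real \<Rightarrow> (nat \<Rightarrow> real \<Rightarrow> real \<Rightarrow> real) \<Rightarrow> bool" where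
  "assumption_B m G \<longleftrightarrow>
     (\<forall>n x. mono (\<lambda>y. G n y (x - y)) \<and> antimono (\<lambda>y. G n y x)) \<and>
     (\<exists>a\<in>{0<..<1}. \<exists>M\<^sub>0>0. \<forall>n. \<forall>x\<ge>0. \<forall>y. \<forall>M\<ge>M\<^sub>0.
        G n (y - M) (x + M) \<le> exp (- a * M) * G n y x) \<and>
     (\<forall>n y. G n y 0 \<ge> 1 - ln m / 100)"

definition Q_tilde_class :: "(real \<Rightarrow> real) set" where
  "Q_tilde_class =
     {q. q ` {0..1} \<subseteq> {0..1} \<and> strict_mono_on {0..1} q \<and> continuous_on {0..1} q \<and>
         q 0 = 0 \<and> q 1 = 1 \<and>
         (\<forall>x\<in>{0<..<1}. q x > x) \<and>
         (\<forall>\<delta>>0. \<exists>c>1. \<forall>x. 0 < x \<and> x \<le> 1 - \<delta> \<longrightarrow> q x > c * x) \<and>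
         (\<forall>\<delta>\<in>{0<..<1}. \<exists>g. (\<forall>\<epsilon>>0. g \<epsilon> \<ge> 0) \<and> (g \<longlongrightarrow> 0) (at_right (0::real)) \<and>
            (\<forall>\<epsilon>>0. \<forall>x\<in>{0..1}. x \<ge> \<delta> \<and> q x \<le> (1 - \<delta>) / (1 + \<epsilon>) \<longrightarrow>
               (let z = (1 + g \<epsilon>) * x in if z > 1 then 1 else q z) \<ge> (1 + \<epsilon>) * q x))}"

definition assumption_C :: "(nat \<Rightarrow> (real \<Rightarrow> real) \<Rightarrow> real \<Rightarrow> real) \<Rightarrow> bool" where
  "assumption_C T \<longleftrightarrow>
     (\<exists>q\<in>Q_tilde_class. \<forall>\<eta>>0. \<exists>B\<ge>0. \<forall>n. \<forall>u\<in>tail_functions. \<forall>x.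
        T n u x \<ge> q (u (x + B)) - \<eta> \<and> T n u x \<le> q (u (x - B)) + \<eta>)"

end

theory Submission
  imports Defs "HOL-Probability.Distribution_Functions"
begin

text \<open>
  Write \<open>u\<^sub>n = 1 - F\<^sub>n\<close> for the tails. The proof has two halves, joined by the notion of a
  \<^emph>\<open>flat stretch\<close>: a long interval over which a tail changes only by a factor close to \<open>1\<close>.

  \<^bold>\<open>No flat stretch near zero.\<close> There are constants such that, for all \<open>n\<close> and \<open>y\<close>,
  \<open>u\<^sub>n(y-d) \<ge> (1+\<epsilon>) u\<^sub>n(y) - K u\<^sub>n(y)^(1+\<beta>).\<close>
  Where \<open>u\<^sub>n(y)\<close> is small this says that \<open>u\<^sub>n\<close> grows by a fixed factor over every step of length
  \<open>d\<close> to the left. The inequality is preserved by the recursion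
  (\<open>left_expanding_rec_op\<close>). Put \<open>v = Q\<^sub>n(u\<^sub>n)\<close> and let \<open>\<nu>\<close> be the probability measure with tail
  \<open>v\<close>, so that \<open>u\<^sub>n\<^sub>+\<^sub>1(x) = \<integral> h d\<nu>\<close> and \<open>u\<^sub>n\<^sub>+\<^sub>1(x-d) = \<integral> k d\<nu>\<close> with
  \<open>h(y) = G\<^sub>n(y,x-y)\<close> and \<open>k(y) = G\<^sub>n(y,x-d-y)\<close>. Assumption A transfers the
  inequality from \<open>u\<^sub>n\<close> to \<open>v\<close>, and the factor \<open>m > 1\<close> in \<open>Q\<^sub>n(x) \<ge> mx\<close> decreases the constant \<open>K\<close>
  by a factor close to \<open>m^(-\<beta>)\<close> (\<open>expansion_transform\<close>). By monotonicity \<open>k(y) \<ge> h(y+d)\<close>, so \<open>k\<close>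
  sees every mass that \<open>h\<close> sees, shifted by \<open>d\<close> and hence enlarged. The difficulty is that the error
  \<open>K v^(1+\<beta>)\<close> is large far to the left, and averaging a convex error works in the wrong
  direction. The exponential decay (G2) repairs this: for \<open>y \<le> x-d\<close> it gives \<open>k(y) \<ge> A h(y)\<close>
  with a fixed \<open>A \<ge> 2\<close>, so the mass on the left does not need the shift.
  Interpolating between the two lower bounds for \<open>k\<close> without losing more than the small gain in \<open>K\<close>
  is the content of \<open>shift_gains_mass\<close>.

  \<^bold>\<open>No flat stretch at any level below one.\<close> Under Assumption C one step of the recursion is, up to a
  bounded shift and a small error, an application of \<open>Q~\<close>. A flat stretch of \<open>u\<^sub>n\<^sub>+\<^sub>1\<close> at a
  level in \<open>[\<delta>\<^sub>1, 1-\<delta>]\<close> therefore comes from a flat stretch of \<open>u\<^sub>n\<close>, by (T2), and at a level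
  lower by a fixed factor, by (T1). After boundedly many steps back in time the level is below
  \<open>\<delta>\<^sub>1\<close>, where flat stretches are excluded, or the initial indicator function is reached, which
  takes no value strictly between \<open>0\<close> and \<open>1\<close> (\<open>ratio_gap\<close>).

  Consequently, below the level \<open>1-\<delta>\<close> each \<open>u\<^sub>n\<close> decays geometrically with a rate that does not
  depend on \<open>n\<close>, and the distance between any two quantile levels in \<open>(0,1)\<close> is bounded
  uniformly in \<open>n\<close> (\<open>tight_if_ratio_gap\<close>).
\<close>

section \<open>Level sets under a probability measure on the line\<close>

lemma (in real_distribution) layer_cake:
  fixes h :: "real \<Rightarrow> real"
  assumes [measurable]: "h \<in> borel_measurable borel" and h: "\<And>y. 0 \<le> h y" "\<And>y. h y \<le> 1"
  shows "(\<integral>y. h y \<partial>M) = (LBINT s:{0<..<1}. measure M {y. s < h y})"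
proof -
  interpret P: pair_sigma_finite M "lborel :: real measure" ..
  have int: "integrable M h"
    by (rule integrable_const_bound[where B=1]) (use h in auto)
  have "ennreal (\<integral>y. h y \<partial>M) = (\<integral>\<^sup>+y. ennreal (h y) \<partial>M)"
    by (rule nn_integral_eq_integral[symmetric]) (use int h in auto)
  also have "\<dots> = (\<integral>\<^sup>+y. emeasure lborel {s. 0 < s \<and> s < 1 \<and> s < h y} \<partial>M)"
  proof (rule nn_integral_cong)
    fix y
    have "{s. 0 < s \<and> s < 1 \<and> s < h y} = {0<..<h y}" using h(2)[of y] by auto
    then show "ennreal (h y) = emeasure lborel {s. 0 < s \<and> s < 1 \<and> s < h y}"
      using h(1)[of y] by simp
  qed
  also have "\<dots> = (\<integral>\<^sup>+y. \<integral>\<^sup>+s. indicator {z. 0 < snd z \<and> snd z < 1 \<and> snd z < h (fst z)} (y, s) \<partial>lborel \<partial>M)"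
  proof (rule nn_integral_cong)
    fix y
    have "emeasure lborel {s. 0 < s \<and> s < 1 \<and> s < h y} = (\<integral>\<^sup>+s. indicator {s. 0 < s \<and> s < 1 \<and> s < h y} s \<partial>lborel)"
      by simp
    also have "\<dots> = (\<integral>\<^sup>+s. indicator {z. 0 < snd z \<and> snd z < 1 \<and> snd z < h (fst z)} (y, s) \<partial>lborel)"
      by (intro nn_integral_cong) (auto split: split_indicator)
    finally show "emeasure lborel {s. 0 < s \<and> s < 1 \<and> s < h y} = \<dots>" .
  qed
  also have "\<dots> = (\<integral>\<^sup>+s. \<integral>\<^sup>+y. indicator {z. 0 < snd z \<and> snd z < 1 \<and> snd z < h (fst z)} (y, s) \<partial>M \<partial>lborel)"
    by (rule P.Fubini'[symmetric]) measurable
  also have "\<dots> = (\<integral>\<^sup>+s. ennreal (indicator {0<..<1} s * measure M {y. s < h y}) \<partial>lborel)"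
  proof (rule nn_integral_cong)
    fix s :: real
    have "(\<integral>\<^sup>+y. indicator {z. 0 < snd z \<and> snd z < 1 \<and> snd z < h (fst z)} (y, s) \<partial>M)
       = (\<integral>\<^sup>+y. indicator {0<..<1} s * indicator {y. s < h y} y \<partial>M)"
      by (intro nn_integral_cong) (auto split: split_indicator)
    also have "\<dots> = indicator {0<..<1} s * emeasure M {y. s < h y}"
      by (subst nn_integral_cmult) auto
    finally show "(\<integral>\<^sup>+y. indicator {z. 0 < snd z \<and> snd z < 1 \<and> snd z < h (fst z)} (y, s) \<partial>M)
       = ennreal (indicator {0<..<1} s * measure M {y. s < h y})"
      by (simp add: emeasure_eq_measure split: split_indicator)
  qed
  finally have eq: "ennreal (\<integral>y. h y \<partial>M) = (\<integral>\<^sup>+s. ennreal (indicator {0<..<1} s * measure M {y. s < h y}) \<partial>lborel)" .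
  have "mono (\<lambda>s. - measure M {y. s < h y})"
    by (auto intro!: monoI finite_measure_mono)
  from borel_measurable_mono[OF this] have [measurable]: "(\<lambda>s. measure M {y. s < h y}) \<in> borel_measurable borel"
    by simp
  have "(LBINT s:{0<..<1}. measure M {y. s < h y}) = enn2real (\<integral>\<^sup>+s. ennreal (indicator {0<..<1} s * measure M {y. s < h y}) \<partial>lborel)"
    unfolding set_lebesgue_integral_def by (subst integral_eq_nn_integral) auto
  also have "\<dots> = (\<integral>y. h y \<partial>M)"
    unfolding eq[symmetric] using h by (simp add: integral_nonneg)
  finally show ?thesis by simp
qed

lemma upset_cases:
  fixes U :: "real set"
  assumes up: "\<And>x y. x \<in> U \<Longrightarrow> x \<le> y \<Longrightarrow> y \<in> U"
  obtains "U = {}" | "U = UNIV" | c where "U = {c<..}" | c where "U = {c..}"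
proof (cases "U = {} \<or> \<not> bdd_below U")
  case True
  then show ?thesis
  proof
    assume "\<not> bdd_below U"
    then have "U = UNIV" using up unfolding bdd_below_def by (metis UNIV_eq_I linear)
    then show ?thesis by (rule that(2))
  qed (rule that(1))
next
  case False
  define c where "c = Inf U"
  have ge: "c \<le> x" if "x \<in> U" for x
    using that False unfolding c_def by (simp add: cInf_lower)
  have gt: "x \<in> U" if "c < x" for x
    using that False up unfolding c_def by (metis cInf_lessD less_imp_le)
  show ?thesis
  proof (cases "c \<in> U")
    case True
    have "U = {c..}" using ge up[OF True] by auto
    then show ?thesis by (rule that(4))
  next
    case False
    have "U = {c<..}" using ge gt False by (auto simp: less_le)
    then show ?thesis by (rule that(3))
  qed
qed

lemma (in real_distribution) measure_Ioi: "measure M {x<..} = 1 - cdf M x"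
proof -
  have "measure M (UNIV - {..x}) = 1 - measure M {..x}"
    using prob_compl[of "{..x}"] by simp
  moreover have "UNIV - {..x} = {x<..}" by auto
  ultimately show ?thesis by (simp add: cdf_def)
qed

lemma (in real_distribution) tendsto_measure_Ioi_left:
  "((\<lambda>x. measure M {x<..}) \<longlongrightarrow> measure M {c..}) (at_left c)"
proof -
  have "measure M (UNIV - {..<c}) = 1 - measure M {..<c}"
    using prob_compl[of "{..<c}"] by simp
  moreover have "UNIV - {..<c} = {c..}" by auto
  ultimately show ?thesis
    using cdf_at_left[of c] by (auto simp: measure_Ioi intro!: tendsto_eq_intros)
qed

text \<open>
  The mass of an upward closed set \<open>U\<close> and of its translate by \<open>-d\<close> are compared through the tails
  of the measure. For an open half-line this is the hypothesis; a closed half-line is a limit of open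
  ones from the left, which is where the continuity of \<open>f\<close> enters.
\<close>

lemma (in real_distribution) upset_shift:
  assumes f: "continuous_on {0..1} f" "f 0 \<le> 0" "f 1 \<le> 1"
    and tail: "\<And>s. f (measure M {s<..}) \<le> measure M {s - d<..}"
    and up: "\<And>x y. x \<in> U \<Longrightarrow> x \<le> y \<Longrightarrow> y \<in> U"
  shows "f (measure M U) \<le> measure M {y. y + d \<in> U}"
proof (rule upset_cases[of U, OF up])
  assume 1: "U = {}" then show ?thesis using f by simp
next
  assume 2: "U = UNIV" then show ?thesis using f prob_space by simp
next
  fix c assume 3: "U = {c<..}"
  have "{y. y + d \<in> U} = {c - d<..}" using 3 by auto
  then show ?thesis using tail[of c] 3 by simp
next
  fix c assume 4: "U = {c..}"
  have eq: "{y. y + d \<in> U} = {c - d..}" using 4 by auto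
  have 1: "((\<lambda>x. f (measure M {x<..})) \<longlongrightarrow> f (measure M {c..})) (at_left c)"
    by (rule continuous_on_tendsto_compose[OF f(1) tendsto_measure_Ioi_left]) auto
  have "filterlim (\<lambda>x. x - d) (at_left (c - d)) (at_left c)"
    by (auto simp: filterlim_at eventually_at_filter intro!: tendsto_eq_intros)
  then have 2: "((\<lambda>x. measure M {x - d<..}) \<longlongrightarrow> measure M {c - d..}) (at_left c)"
    by (rule filterlim_compose[OF tendsto_measure_Ioi_left])
  show ?thesis unfolding eq unfolding 4
    by (rule tendsto_le[OF _ 2 1]) (use tail in auto)
qed

section \<open>Expansion with a power error, and its compensation\<close>

text \<open>
  The function \<open>z^(1+\<beta>)\<close>, continued linearly with slope \<open>c^\<beta>\<close> beyond \<open>c\<close>.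
\<close>

definition capped :: "real \<Rightarrow> real \<Rightarrow> real \<Rightarrow> real" where
  "capped \<beta> c z = z * min z c powr \<beta>"

lemma mult_powr_swap:
  fixes a b \<beta> :: real
  assumes "0 \<le> a" "a \<le> b" "0 < \<beta>" "\<beta> \<le> 1"
  shows "a * b powr \<beta> \<le> b * a powr \<beta>"
proof (cases "a = 0")
  case False
  then have ab: "0 < a" "0 < b" using assms by auto
  have "(b / a) powr \<beta> \<le> (b / a) powr 1"
    using assms ab by (intro powr_mono) auto
  then show ?thesis
    using ab by (simp add: powr_divide field_simps)
qed (use assms in auto)

lemma capped_diff_le:
  fixes a b c \<beta> :: real
  assumes "0 \<le> a" "a \<le> b" "0 < \<beta>" "\<beta> \<le> 1" "0 \<le> c"
  shows "capped \<beta> c b - capped \<beta> c a \<le> 2 * min b c powr \<beta> * (b - a)"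
proof -
  define p where "p = min b c"
  define q where "q = min a c"
  have le: "q \<le> p" "0 \<le> q" "p - q \<le> b - a" "q \<le> a" using assms by (auto simp: p_def q_def)
  have "a * (p powr \<beta> - q powr \<beta>) \<le> p powr \<beta> * (b - a)"
  proof (cases "c \<le> a")
    case True
    then have "p = q" using assms by (auto simp: p_def q_def)
    then show ?thesis using assms by simp
  next
    case False
    then have qa: "q = a" by (simp add: q_def)
    define X where "X = p powr \<beta>"
    define Y where "Y = a powr \<beta>"
    have X: "a * X \<le> p * Y" "0 \<le> X" "0 \<le> Y"
      unfolding X_def Y_def using mult_powr_swap[of a p \<beta>] assms le qa by auto
    have "a * (X - Y) \<le> X * (p - a)"
    proof (cases "p = 0")
      case True then show ?thesis using le qa by simp
    next
      case False
      then have p: "0 < p" using le by linarith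
      have "a * (a * X) \<le> a * (p * Y)" using X assms by (intro mult_left_mono) auto
      moreover have "0 \<le> X * (p - a)\<^sup>2" using X by simp
      ultimately have "p * (a * (X - Y)) \<le> p * (X * (p - a))"
        by (simp add: power2_eq_square algebra_simps)
      then show ?thesis using p by simp
    qed
    also have "\<dots> \<le> X * (b - a)" using X le qa by (intro mult_left_mono) auto
    finally show ?thesis unfolding X_def Y_def qa .
  qed
  then show ?thesis unfolding capped_def p_def[symmetric] q_def[symmetric] by (simp add: algebra_simps)
qed

lemma capped_mono:
  assumes "0 \<le> a" "a \<le> b" "0 < \<beta>" "0 \<le> c"
  shows "capped \<beta> c a \<le> capped \<beta> c b"
  unfolding capped_def using assms by (intro mult_mono powr_mono2) auto

text \<open>
  The least value at \<open>y-d\<close> that an inequality of the form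
  \<open>v(y-d) \<ge> (1+\<epsilon>)v(y) - K v(y)^(1+\<beta>)\<close> allows a nonincreasing function \<open>v\<close> with
  \<open>v(y) = z\<close>.
\<close>

definition expansion :: "real \<Rightarrow> real \<Rightarrow> real \<Rightarrow> real \<Rightarrow> real" where
  "expansion \<epsilon> K \<beta> z = max z ((1 + \<epsilon>) * z - K * (z * z powr \<beta>))"

text \<open>
  Let \<open>f\<close> be the expansion. The inequality \<open>(1+\<epsilon>-\<kappa>)z \<le> f(z)\<close> holds for \<open>z \<le> l\<close> but
  may fail for larger \<open>z\<close>. The correction \<open>P\<close> restores it for all \<open>z\<close> in the form
  \<open>(1+\<epsilon>-\<kappa>)z \<le> f(z) - P(f(z)) + A P(z)\<close>. The other properties of \<open>P\<close> are those that
  make the correction affordable in \<open>shift_gains_mass\<close>: it is nondecreasing and \<open>1\<close>-Lipschitz, and it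
  vanishes up to \<open>l\<close>.

  A multiple of \<open>z^(1+\<beta>) - l^(1+\<beta>)\<close> is natural for \<open>P\<close>, since it grows like the error
  \<open>K z^(1+\<beta>)\<close> that it must absorb. The price \<open>P(f(z)) - P(z)\<close> is then of order
  \<open>\<epsilon> K z^(1+\<beta>)\<close>, which explains the factor \<open>1 + 6\<epsilon>\<close> in the hypothesis on
  \<open>\<kappa>\<close>.
\<close>

lemma compensator_exists:
  fixes \<epsilon> K \<beta> A l \<kappa> :: real
  assumes e: "0 < \<epsilon>" "\<epsilon> \<le> 1/6" and K: "0 < K" and b: "0 < \<beta>" "\<beta> \<le> 1" and A: "2 \<le> A"
    and l: "0 \<le> l" and kap: "(1 + 6 * \<epsilon>) * K * l powr \<beta> \<le> \<kappa>" "\<kappa> \<le> \<epsilon>"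
  obtains P :: "real \<Rightarrow> real" where
    "mono_on {0..} P" "\<And>z. P z \<ge> 0" "\<And>z. z \<ge> 0 \<Longrightarrow> z \<le> l \<Longrightarrow> P z = 0"
    "\<And>x y. 0 \<le> x \<Longrightarrow> x \<le> y \<Longrightarrow> P y - P x \<le> y - x"
    "\<And>z. 0 \<le> z \<Longrightarrow> (1 + \<epsilon> - \<kappa>) * z \<le> expansion \<epsilon> K \<beta> z - P (expansion \<epsilon> K \<beta> z) + A * P z"
proof
  \<comment> \<open>At the level \<open>c\<close> the error \<open>K c^\<beta>\<close> equals \<open>\<epsilon>\<close>, so that the expansion is the
    identity beyond \<open>c\<close>.\<close>
  define c where "c = (\<epsilon> / K) powr (1/\<beta>)"
  define g where "g = capped \<beta> c"
  \<comment> \<open>With this slope \<open>(A-1) P(z)\<close> is twice the error \<open>K z^(1+\<beta>)\<close>, up to the constant at \<open>l\<close>.\<close>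
  define p where "p = 2 * K / (A - 1)"
  define P where "P = (\<lambda>z. p * max 0 (g z - g l))"
  have c: "0 < c" "c powr \<beta> = \<epsilon> / K" using e K b by (auto simp: c_def powr_powr)
  have p: "0 < p" "p \<le> 2 * K" using K A by (auto simp: p_def field_simps)
  have pA: "(A - 1) * p = 2 * K" using A by (simp add: p_def)
  have gmono: "g x \<le> g y" if "0 \<le> x" "x \<le> y" for x y
    unfolding g_def using that b c by (intro capped_mono) auto
  have mpow: "min z c powr \<beta> \<le> \<epsilon> / K" if "0 \<le> z" for z
    unfolding c(2)[symmetric] using that b c by (intro powr_mono2) auto
  have glip: "g y - g x \<le> 2 * \<epsilon> / K * (y - x)" if "0 \<le> x" "x \<le> y" for x y
  proof -
    have "g y - g x \<le> 2 * min y c powr \<beta> * (y - x)"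
      unfolding g_def using that b c by (intro capped_diff_le) auto
    also have "\<dots> \<le> 2 * (\<epsilon> / K) * (y - x)"
      using mpow[of y] that by (intro mult_right_mono mult_left_mono) auto
    finally show ?thesis by simp
  qed
  have Plip: "P y - P x \<le> p * (g y - g x)" if "0 \<le> x" "x \<le> y" for x y
    using gmono[OF that] p unfolding P_def
    by (auto simp: max_def algebra_simps intro: mult_left_mono)
  show "mono_on {0..} P"
    unfolding P_def using gmono p by (intro mono_onI mult_left_mono) (auto simp: max_def, smt (verit, best))
  show P0: "P z \<ge> 0" for z unfolding P_def using p by simp
  show Pl: "P z = 0" if "z \<ge> 0" "z \<le> l" for z unfolding P_def using gmono[OF that] by simp
  show "P y - P x \<le> y - x" if "0 \<le> x" "x \<le> y" for x y
  proof -
    have "P y - P x \<le> 2 * K * (2 * \<epsilon> / K * (y - x))"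
      using Plip[OF that] mult_mono[OF p(2) glip[OF that]] gmono[OF that] K by auto
    also have "\<dots> = 4 * \<epsilon> * (y - x)" using K by simp
    also have "\<dots> \<le> 1 * (y - x)" using e that by (intro mult_right_mono) auto
    finally show ?thesis by simp
  qed
  show "(1 + \<epsilon> - \<kappa>) * z \<le> expansion \<epsilon> K \<beta> z - P (expansion \<epsilon> K \<beta> z) + A * P z" if z: "0 \<le> z" for z
  proof -
    define L where "L = l powr \<beta>"
    have L0: "0 \<le> L" by (simp add: L_def)
    have L: "K * L \<le> \<epsilon>"
    proof -
      have "1 * (K * L) \<le> (1 + 6 * \<epsilon>) * (K * L)" using e K L0 by (intro mult_right_mono) auto
      then show ?thesis using kap by (simp add: L_def mult.assoc)
    qed
    have lc: "l \<le> c"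
    proof (rule ccontr)
      assume "\<not> l \<le> c"
      then have "c powr \<beta> < L" unfolding L_def using c b by (intro powr_less_mono2) auto
      then show False using L c K by (simp add: field_simps)
    qed
    have gl: "g l = l * L" using lc by (simp add: g_def capped_def L_def min_absorb1)
    show ?thesis
    proof (cases "z \<le> c")
      case False
      have "c powr \<beta> \<le> z powr \<beta>" using False c b by (intro powr_mono2) auto
      then have "\<epsilon> \<le> K * z powr \<beta>" using c K by (simp add: field_simps)
      then have "\<epsilon> * z \<le> K * z powr \<beta> * z" using z by (intro mult_right_mono) auto
      then have f: "expansion \<epsilon> K \<beta> z = z" unfolding expansion_def by (simp add: algebra_simps)
      have gz: "g z = z * (\<epsilon> / K)" using False c by (simp add: g_def capped_def min_absorb2)
      have "p * (g z - g l) \<le> P z" unfolding P_def using p by (intro mult_left_mono) auto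
      then have "(A - 1) * (p * (g z - g l)) \<le> (A - 1) * P z" using A by (intro mult_left_mono) auto
      then have 1: "2 * K * (g z - g l) \<le> (A - 1) * P z" using pA by (simp add: mult.assoc[symmetric])
      have "2 * K * (g z - g l) = 2 * \<epsilon> * z - 2 * (K * L) * l"
        unfolding gz gl using K by (simp add: field_simps)
      moreover have "(K * L) * l \<le> \<kappa> * l" "\<kappa> * l \<le> \<kappa> * z" "\<kappa> * z \<le> \<epsilon> * z"
      proof -
        have "1 * (K * L) \<le> (1 + 6 * \<epsilon>) * (K * L)" using e K L0 by (intro mult_right_mono) auto
        then have kL: "K * L \<le> \<kappa>" using kap by (simp add: L_def mult.assoc)
        then show "(K * L) * l \<le> \<kappa> * l" using l by (intro mult_right_mono)
        have "0 \<le> K * L" using K L0 by simp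
        then show "\<kappa> * l \<le> \<kappa> * z" using kL lc False by (intro mult_left_mono) auto
        show "\<kappa> * z \<le> \<epsilon> * z" using kap z by (intro mult_right_mono)
      qed
      ultimately have "(\<epsilon> - \<kappa>) * z \<le> (A - 1) * P z" using 1 by (simp add: algebra_simps)
      then show ?thesis unfolding f by (simp add: algebra_simps)
    next
      case True
      define Z where "Z = z powr \<beta>"
      have Z0: "0 \<le> Z" by (simp add: Z_def)
      have gz: "g z = z * Z" using True by (simp add: g_def capped_def Z_def min_absorb1)
      define w where "w = expansion \<epsilon> K \<beta> z"
      have w1: "z \<le> w" "(1 + \<epsilon>) * z - K * (z * Z) \<le> w" unfolding w_def expansion_def Z_def by auto
      have w2: "w \<le> (1 + \<epsilon>) * z"
        unfolding w_def expansion_def using e z K by (auto simp: algebra_simps)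
      have "min w c powr \<beta> \<le> ((1 + \<epsilon>) * z) powr \<beta>"
        using w1 w2 z b c by (intro powr_mono2) auto
      also have "\<dots> = (1 + \<epsilon>) powr \<beta> * Z" using e z by (simp add: powr_mult Z_def)
      also have "\<dots> \<le> (1 + \<epsilon>) powr 1 * Z" using e b Z0 by (intro mult_right_mono powr_mono) auto
      finally have mw: "min w c powr \<beta> \<le> (1 + \<epsilon>) * Z" using e by simp
      have "g w - g z \<le> 2 * min w c powr \<beta> * (w - z)"
        unfolding g_def using w1 z b c by (intro capped_diff_le) auto
      also have "\<dots> \<le> 2 * ((1 + \<epsilon>) * Z) * (\<epsilon> * z)"
        using mw w1 w2 e Z0 z by (intro mult_mono) (auto simp: algebra_simps)
      also have "\<dots> = (1 + \<epsilon>) * (2 * \<epsilon> * (Z * z))" by simp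
      also have "\<dots> \<le> (3/2) * (2 * \<epsilon> * (Z * z))"
        using e Z0 z by (intro mult_right_mono) auto
      finally have gwz: "g w - g z \<le> 3 * \<epsilon> * (z * Z)" by (simp add: mult_ac)
      have "P w - P z \<le> p * (g w - g z)" by (rule Plip) (use z w1 in auto)
      also have "\<dots> \<le> 2 * K * (3 * \<epsilon> * (z * Z))"
        using p gwz gmono[OF z w1(1)] by (intro mult_mono) auto
      finally have Pwz: "P w - P z \<le> 6 * \<epsilon> * (K * (z * Z))" by (simp add: mult_ac)
      have kap': "(1 + 6 * \<epsilon>) * (K * L) \<le> \<kappa>" using kap by (simp add: L_def mult.assoc)
      have main: "(1 + \<epsilon> - \<kappa>) * z \<le> w - (P w - P z) + (A - 1) * P z"
      proof (cases "z \<le> l")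
        case True
        have "Z \<le> L" unfolding Z_def L_def using True z b by (intro powr_mono2) auto
        then have "(1 + 6 * \<epsilon>) * (K * Z) \<le> (1 + 6 * \<epsilon>) * (K * L)" using e K by (intro mult_left_mono) auto
        then have "(1 + 6 * \<epsilon>) * (K * Z) * z \<le> \<kappa> * z" using kap' z by (intro mult_right_mono) auto
        then have "K * (z * Z) + 6 * \<epsilon> * (K * (z * Z)) \<le> \<kappa> * z" by (simp add: algebra_simps)
        moreover have "0 \<le> (A - 1) * P z" using A P0 by simp
        ultimately show ?thesis using w1 Pwz by (simp add: algebra_simps)
      next
        case False
        have ZL: "L \<le> Z" unfolding Z_def L_def using False l b by (intro powr_mono2) auto
        have "p * (g z - g l) \<le> P z" unfolding P_def using p by (intro mult_left_mono) auto
        then have "(A - 1) * (p * (g z - g l)) \<le> (A - 1) * P z" using A by (intro mult_left_mono) auto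
        then have 1: "2 * K * (z * Z - l * L) \<le> (A - 1) * P z" using pA gz gl by (simp add: mult.assoc[symmetric])
        have "(1 + 6 * \<epsilon>) * (K * L) * z \<le> \<kappa> * z" using kap' z by (intro mult_right_mono) auto
        moreover have "0 \<le> (1 - 6 * \<epsilon>) * (K * z) * (Z - L)" using e K z ZL by simp
        moreover have "0 \<le> 2 * K * L * (z - l)" using K L0 False by simp
        ultimately show ?thesis using w1 Pwz 1 by (simp add: algebra_simps)
      qed
      then show ?thesis unfolding w_def by (simp add: algebra_simps)
    qed
  qed
qed

section \<open>Comparison of two integrals along a shift\<close>

lemma continuous_on_expansion:
  assumes "0 < \<beta>" shows "continuous_on {0..1} (expansion \<epsilon> K \<beta>)"
  unfolding expansion_def using assms by (intro continuous_intros continuous_on_powr') auto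

text \<open>
  Write \<open>H(s)\<close> and \<open>J(s)\<close> for the masses of \<open>{h > s}\<close> and \<open>{k > s}\<close>, and \<open>f\<close> for the expansion.
  The shift gives \<open>J(s) \<ge> f(H(s))\<close>, and the factor \<open>A\<close> gives \<open>J(s) \<ge> H(s/A)\<close> as soon as
  \<open>H(s/A) > l\<close>, because then the set \<open>{h > s/A}\<close> reaches to the left of \<open>w\<close>. If \<open>P\<close> is
  nondecreasing, \<open>1\<close>-Lipschitz and vanishes on \<open>[0,l]\<close>, both bounds together imply
  \<open>J(s) \<ge> f(H(s)) - P(f(H(s))) + P(H(s/A)).\<close>
  Integration over \<open>s\<close> turns the last term into \<open>A \<integral> P(H(s)) ds\<close>, and the choice of \<open>P\<close> in
  \<open>compensator_exists\<close> makes the right-hand side at least \<open>(1+\<epsilon>-\<kappa>)\<integral> H(s) ds\<close>.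
\<close>

lemma (in real_distribution) shift_gains_mass:
  fixes h k :: "real \<Rightarrow> real"
  assumes h: "mono h" "\<And>y. 0 \<le> h y" "\<And>y. h y \<le> 1"
    and k: "mono k" "\<And>y. 0 \<le> k y" "\<And>y. k y \<le> 1"
    and shift: "\<And>y. h (y + d) \<le> k y"
    and boost: "\<And>y. y \<le> w \<Longrightarrow> A * h y \<le> k y"
    and tail: "\<And>s. expansion \<epsilon> K \<beta> (measure M {s<..}) \<le> measure M {s - d<..}"
    and w: "measure M {w<..} \<le> l"
    and e: "0 < \<epsilon>" "\<epsilon> \<le> 1/6" "\<epsilon> \<le> K" and b: "0 < \<beta>" "\<beta> \<le> 1" and A: "2 \<le> A"
    and kap: "(1 + 6 * \<epsilon>) * K * l powr \<beta> \<le> \<kappa>" "\<kappa> \<le> \<epsilon>"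
  shows "(1 + \<epsilon> - \<kappa>) * (\<integral>y. h y \<partial>M) \<le> (\<integral>y. k y \<partial>M)"
proof -
  have [measurable]: "h \<in> borel_measurable borel" "k \<in> borel_measurable borel"
    using h k by (auto intro: borel_measurable_mono)
  have K: "0 < K" using e by linarith
  have l: "0 \<le> l" using w measure_nonneg[of M "{w<..}"] by linarith
  obtain P :: "real \<Rightarrow> real" where P: "mono_on {0..} P" "\<And>z. P z \<ge> 0" "\<And>z. z \<ge> 0 \<Longrightarrow> z \<le> l \<Longrightarrow> P z = 0"
    "\<And>x y. 0 \<le> x \<Longrightarrow> x \<le> y \<Longrightarrow> P y - P x \<le> y - x"
    "\<And>z. 0 \<le> z \<Longrightarrow> (1 + \<epsilon> - \<kappa>) * z \<le> expansion \<epsilon> K \<beta> z - P (expansion \<epsilon> K \<beta> z) + A * P z"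
    using compensator_exists[OF e(1,2) K b A l kap] by metis
  define f where "f = expansion \<epsilon> K \<beta>"
  define H where "H = (\<lambda>s. measure M {y. s < h y})"
  define J where "J = (\<lambda>s. measure M {y. s < k y})"
  have H01: "0 \<le> H s" "H s \<le> 1" for s by (auto simp: H_def)
  have J01: "0 \<le> J s" "J s \<le> 1" for s by (auto simp: J_def)
  have f_ge: "z \<le> f z" for z by (simp add: f_def expansion_def)
  have step1: "f (H s) \<le> J s" for s
  proof -
    have "f (H s) \<le> measure M {y. y + d \<in> {y. s < h y}}"
      unfolding H_def f_def
    proof (rule upset_shift[OF continuous_on_expansion[OF b(1)]])
      show "expansion \<epsilon> K \<beta> 0 \<le> 0" "expansion \<epsilon> K \<beta> 1 \<le> 1" using e by (auto simp: expansion_def)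
      show "\<And>s. expansion \<epsilon> K \<beta> (measure M {s<..}) \<le> measure M {s - d<..}" by (rule tail)
    qed (use monoD[OF h(1)] in force)
    also have "\<dots> \<le> J s"
      unfolding J_def using shift by (intro finite_measure_mono) (auto intro: less_le_trans)
    finally show ?thesis .
  qed
  have witness: "\<exists>y\<le>w. s / A < h y" if "l < H (s / A)" for s
  proof (rule ccontr)
    assume "\<not> (\<exists>y\<le>w. s / A < h y)"
    then have "w < y" if "s / A < h y" for y using that not_le_imp_less by blast
    then have "{y. s / A < h y} \<subseteq> {w<..}" by auto
    then have "H (s / A) \<le> measure M {w<..}" unfolding H_def by (intro finite_measure_mono) auto
    then show False using that w by linarith
  qed
  have boosted: "s < k y" if "y \<le> w" "s / A < h y" for s y
  proof -
    have "s < A * h y" using that A by (simp add: field_simps)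
    then show ?thesis using boost[OF that(1)] by linarith
  qed
  have step2: "H (s / A) \<le> J s" if "l < H (s / A)" for s
  proof -
    from witness[OF that] obtain y0 where y0: "y0 \<le> w" "s / A < h y0" by blast
    have "s < k y" if "s / A < h y" for y
      using boosted[of y s] boosted[OF y0] that monoD[OF k(1), of y0 y] y0(1) by (cases "y \<le> w") auto
    then show ?thesis unfolding H_def J_def by (intro finite_measure_mono) auto
  qed
  have step3: "f (H s) - P (f (H s)) + P (H (s / A)) \<le> J s" for s
  proof (cases "H (s / A) \<le> l")
    case True
    then show ?thesis using P(2)[of "f (H s)"] P(3)[OF H01(1) True] step1[of s] by linarith
  next
    case False
    then have le: "H (s / A) \<le> J s" by (intro step2) simp
    have f0: "0 \<le> f (H s)" using f_ge[of "H s"] H01[of s] by linarith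
    show ?thesis
    proof (cases "H (s / A) \<le> f (H s)")
      case True
      then have "P (H (s / A)) \<le> P (f (H s))" using f0 H01 by (intro mono_onD[OF P(1)]) auto
      then show ?thesis using step1[of s] by linarith
    next
      case False
      then show ?thesis using P(4)[OF f0, of "H (s / A)"] le by linarith
    qed
  qed
  have "mono (\<lambda>s. - H s)" "mono (\<lambda>s. - J s)" "mono (\<lambda>s. - P (H s))"
    unfolding H_def J_def
    by (auto intro!: monoI finite_measure_mono mono_onD[OF P(1)])
  from this[THEN borel_measurable_mono]
  have [measurable]: "H \<in> borel_measurable borel" "J \<in> borel_measurable borel"
    and PHm: "(\<lambda>s. P (H s)) \<in> borel_measurable borel" by simp_all
  have PHAm: "(\<lambda>s. P (H (s / A))) \<in> borel_measurable borel"
    using measurable_compose[OF _ PHm, of "\<lambda>s. s / A" borel] by simp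
  have fHm [measurable]: "(\<lambda>s. f (H s)) \<in> borel_measurable borel"
    unfolding f_def expansion_def by measurable
  have "mono (\<lambda>z. P (max 0 z))" by (auto intro!: monoI mono_onD[OF P(1)])
  then have "(\<lambda>z. P (max 0 z)) \<in> borel_measurable borel" by (rule borel_measurable_mono)
  from measurable_compose[OF fHm this] have PfHm: "(\<lambda>s. P (f (H s))) \<in> borel_measurable borel"
    using f_ge H01(1) by (simp add: max_absorb2 order_trans[OF H01(1) f_ge])
  have int: "set_integrable lborel {0<..<1::real} q"
    if "q \<in> borel_measurable borel" "\<And>s. \<bar>q s\<bar> \<le> C" for q :: "real \<Rightarrow> real" and C
    unfolding set_integrable_def
    by (rule integrableI_bounded_set_indicator[where B=C]) (use that in auto)
  have Pb: "\<bar>P z\<bar> \<le> P 1" if "0 \<le> z" "z \<le> 1" for z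
    using P(2)[of z] mono_onD[OF P(1), of z 1] that by auto
  have f01: "0 \<le> f (H s)" "f (H s) \<le> 1" for s
    using f_ge[of "H s"] H01[of s] step1[of s] J01[of s] by linarith+
  have iH: "set_integrable lborel {0<..<1} H" by (rule int[of _ 1]) (use H01 in auto)
  have iJ: "set_integrable lborel {0<..<1} J" by (rule int[of _ 1]) (use J01 in auto)
  have ifH: "set_integrable lborel {0<..<1} (\<lambda>s. f (H s))" by (rule int[of _ 1]) (use f01 in auto)
  have iPfH: "set_integrable lborel {0<..<1} (\<lambda>s. P (f (H s)))"
    by (rule int[OF PfHm, of "P 1"]) (use f01 Pb in auto)
  have iPH: "set_integrable lborel {0<..<1} (\<lambda>s. P (H s))"
    by (rule int[OF PHm, of "P 1"]) (use H01 Pb in auto)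
  have iPHA: "set_integrable lborel {0<..<1} (\<lambda>s. P (H (s / A)))"
    by (rule int[OF PHAm, of "P 1"]) (use H01 Pb in auto)
  \<comment> \<open>The substitution maps \<open>(0,1)\<close> to \<open>(0,1/A)\<close>. The remaining levels \<open>s \<ge> 1/A\<close> contribute nothing:
    if \<open>H(s) > l\<close> there, then \<open>k\<close> would exceed \<open>A s \<ge> 1\<close> somewhere.\<close>
  have scale: "(LBINT s:{0<..<1}. P (H (s / A))) = A * (LBINT s:{0<..<1}. P (H s))"
  proof -
    have "(LBINT s:{0<..<1}. P (H s)) = \<bar>1 / A\<bar> *\<^sub>R (\<integral>s. indicator {0<..<1} (0 + (1 / A) * s) *\<^sub>R P (H (0 + (1 / A) * s)) \<partial>lborel)"
      unfolding set_lebesgue_integral_def using A by (intro lborel_integral_real_affine) auto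
    also have "(\<integral>s. indicator {0<..<1} (0 + (1 / A) * s) *\<^sub>R P (H (0 + (1 / A) * s)) \<partial>lborel)
        = (LBINT s:{0<..<1}. P (H (s / A)))"
      unfolding set_lebesgue_integral_def
    proof (intro Bochner_Integration.integral_cong refl)
      fix s :: real
      show "indicator {0<..<1} (0 + (1 / A) * s) *\<^sub>R P (H (0 + (1 / A) * s)) = indicator {0<..<1} s *\<^sub>R P (H (s / A))"
      proof (cases "1 \<le> s")
        case True
        have "H (s / A) \<le> l"
        proof (rule ccontr)
          assume "\<not> H (s / A) \<le> l"
          then obtain y where "y \<le> w" "s / A < h y" using witness[of s] by auto
          then show False using boosted[of y s] k(3)[of y] True by linarith
        qed
        then have "P (H (s / A)) = 0" using H01 P(3) by blast
        then show ?thesis by simp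
      next
        case False
        then have "0 < s / A \<and> s / A < 1 \<longleftrightarrow> 0 < s" using A by (auto simp: field_simps)
        then show ?thesis using False by (auto simp: indicator_def)
      qed
    qed
    finally show ?thesis using A by (simp add: field_simps)
  qed
  have "(1 + \<epsilon> - \<kappa>) * (\<integral>y. h y \<partial>M) = (LBINT s:{0<..<1}. (1 + \<epsilon> - \<kappa>) * H s)"
    using layer_cake[of h] h by (simp add: H_def)
  also have "\<dots> \<le> (LBINT s:{0<..<1}. f (H s) - P (f (H s)) + A * P (H s))"
    by (intro set_integral_mono set_integral_add set_integral_diff set_integrable_mult_right iH ifH iPfH iPH)
       (use P(5) H01 in \<open>auto simp: f_def\<close>)
  also have "\<dots> = (LBINT s:{0<..<1}. f (H s)) - (LBINT s:{0<..<1}. P (f (H s))) + A * (LBINT s:{0<..<1}. P (H s))"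
    using ifH iPfH iPH by (simp add: set_integral_add set_integral_diff)
  also have "\<dots> = (LBINT s:{0<..<1}. f (H s) - P (f (H s)) + P (H (s / A)))"
    using ifH iPfH iPHA by (simp add: set_integral_add set_integral_diff scale)
  also have "\<dots> \<le> (LBINT s:{0<..<1}. J s)"
    by (intro set_integral_mono set_integral_add set_integral_diff iJ ifH iPfH iPHA step3)
  also have "\<dots> = (\<integral>y. k y \<partial>M)"
    using layer_cake[of k] k by (simp add: J_def)
  finally show ?thesis .
qed

section \<open>One step of the recursion\<close>

lemma tail_functionsD:
  assumes "u \<in> tail_functions"
  shows "antimono u" "\<And>x. 0 \<le> u x" "\<And>x. u x \<le> 1" "\<And>x. (u \<longlongrightarrow> u x) (at_right x)"
    "(u \<longlongrightarrow> 1) at_bot" "(u \<longlongrightarrow> 0) at_top"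
proof -
  have r: "range u \<subseteq> {0..1}" and d: "distribution_function (\<lambda>x. 1 - u x)"
    using assms by (auto simp: tail_functions_def)
  have u01: "u x \<in> {0..1}" for x using r by blast
  show "0 \<le> u x" for x using u01[of x] by simp
  show "u x \<le> 1" for x using u01[of x] by simp
  show "antimono u" using d by (auto simp: distribution_function_def mono_def antimono_def)
  show "(u \<longlongrightarrow> u x) (at_right x)" for x
  proof -
    have "((\<lambda>x. 1 - u x) \<longlongrightarrow> 1 - u x) (at_right x)"
      using d by (auto simp: distribution_function_def continuous_within)
    from tendsto_diff[OF tendsto_const[of 1] this] show ?thesis by simp
  qed
  have "((\<lambda>x. 1 - u x) \<longlongrightarrow> 0) at_bot" "((\<lambda>x. 1 - u x) \<longlongrightarrow> 1) at_top"
    using d by (auto simp: distribution_function_def)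
  from this[THEN tendsto_diff[OF tendsto_const[of 1]]]
  show "(u \<longlongrightarrow> 1) at_bot" "(u \<longlongrightarrow> 0) at_top" by simp_all
qed

text \<open>
  A nondecreasing function onto an interval has no room for jumps. Extending \<open>q\<close> by the identity
  outside the unit interval makes the image open, as the criterion for monotone functions on a
  linear order requires.
\<close>

lemma mono_onto_unit_continuous:
  fixes q :: "real \<Rightarrow> real"
  assumes m: "mono_on {0..1} q" and onto: "q ` {0..1} = {0..1}" and q01: "q 0 = 0" "q 1 = 1"
  shows "continuous_on {0..1} q"
proof -
  define c where "c = (\<lambda>x::real. max 0 (min 1 x))"
  define f where "f = (\<lambda>x. q (c x) + (x - c x))"
  have "f x \<le> f y" if "x \<le> y" for x y
    unfolding f_def
    by (intro add_mono mono_onD[OF m]) (use that in \<open>auto simp: c_def\<close>)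
  moreover have "range f = UNIV"
  proof (safe, goal_cases)
    case (2 y)
    consider "y < 0" | "1 < y" | "y \<in> {0..1}" by fastforce
    then show ?case
    proof cases
      case 1 then have "f y = y" using q01 by (simp add: f_def c_def)
      then show ?thesis by (rule range_eqI[OF sym])
    next
      case 2 then have "f y = y" using q01 by (simp add: f_def c_def)
      then show ?thesis by (rule range_eqI[OF sym])
    next
      case 3
      then obtain x where x: "x \<in> {0..1}" "q x = y" using onto by (metis imageE)
      then have "f x = y" by (auto simp: f_def c_def)
      then show ?thesis by (rule range_eqI[OF sym])
    qed
  qed simp
  ultimately have "continuous_on UNIV f" by (intro continuous_onI_mono) auto
  then have "continuous_on {0..1} f" by (rule continuous_on_subset) simp
  moreover have "f x = q x" if "x \<in> {0..1}" for x using that by (simp add: f_def c_def)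
  ultimately show ?thesis by (rule continuous_on_eq)
qed

lemma
  fixes q u :: "real \<Rightarrow> real"
  assumes u: "u \<in> tail_functions"
    and m: "mono_on {0..1} q" and onto: "q ` {0..1} = {0..1}" and q01: "q 0 = 0" "q 1 = 1"
  shows real_distribution_tail: "real_distribution (interval_measure (\<lambda>y. - q (u y)))"
    and measure_tail: "measure (interval_measure (\<lambda>y. - q (u y))) {s<..} = q (u s)"
proof -
  note u = tail_functionsD[OF u]
  define F where "F = (\<lambda>y. 1 - q (u y))"
  \<comment> \<open>Adding a constant to the integrator does not change the measure.\<close>
  have eq: "interval_measure (\<lambda>y. - q (u y)) = interval_measure F"
    by (simp add: interval_measure_def F_def)
  have q: "continuous_on {0..1} q" by (rule mono_onto_unit_continuous[OF m onto q01])
  have mono: "F x \<le> F y" if "x \<le> y" for x y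
    using that antimonoD[OF u(1)] u(2,3) mono_onD[OF m] by (auto simp: F_def)
  have rc: "continuous (at_right a) F" for a
    unfolding F_def continuous_within
    by (intro tendsto_intros continuous_on_tendsto_compose[OF q u(4)]) (use u in auto)
  have bot: "(F \<longlongrightarrow> 0) at_bot"
    unfolding F_def using continuous_on_tendsto_compose[OF q u(5)] u q01
    by (auto intro!: tendsto_eq_intros)
  have top: "(F \<longlongrightarrow> 1) at_top"
    unfolding F_def using continuous_on_tendsto_compose[OF q u(6)] u q01
    by (auto intro!: tendsto_eq_intros)
  show rd: "real_distribution (interval_measure (\<lambda>y. - q (u y)))"
    unfolding eq by (rule real_distribution_interval_measure[OF mono rc bot top])
  show "measure (interval_measure (\<lambda>y. - q (u y))) {s<..} = q (u s)"
    using real_distribution.measure_Ioi[OF rd, of s] cdf_interval_measure[OF mono rc bot]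
    by (simp add: eq F_def)
qed

text \<open>
  Where \<open>K u(y)^\<beta> < \<epsilon>\<close>, this says that \<open>u\<close> gains a factor larger than \<open>1\<close> over a step of
  length \<open>d\<close> to the left. At higher levels it follows from monotonicity alone, so it only restricts
  the behaviour of \<open>u\<close> near zero.
\<close>

definition left_expanding :: "real \<Rightarrow> real \<Rightarrow> real \<Rightarrow> real \<Rightarrow> (real \<Rightarrow> real) \<Rightarrow> bool" where
  "left_expanding \<epsilon> K \<beta> d u \<longleftrightarrow>
     (\<forall>y. (1 + \<epsilon>) * u y - K * (u y * u y powr \<beta>) \<le> u (y - d))"

text \<open>
  Near zero, Assumption A bounds how much \<open>q\<close> can shrink the ratio of two values, with an error
  \<open>c q(a)^\<theta>\<close> that is absorbed into the new constant as \<open>2c\<close>. The old error \<open>K a^\<beta>\<close> is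
  at most \<open>K\<mu>^(-\<beta>) q(a)^\<beta>\<close>, because \<open>\<mu> a \<le> q(a)\<close>. Thus the constant improves by the factor
  \<open>\<mu>^(-\<beta>)\<close>, up to an additive term that does not depend on \<open>K\<close>.
\<close>

lemma expansion_transform:
  fixes q :: "real \<Rightarrow> real"
  assumes m: "mono_on {0..1} q" "q 0 = 0" "q ` {0..1} = {0..1}"
    and lin: "\<And>x. x \<in> {0..1} \<Longrightarrow> x \<le> 2 * \<delta> \<Longrightarrow> mu * x \<le> q x" and mu: "1 \<le> mu" and \<delta>: "0 < \<delta>"
    and ratio: "\<And>x1 x2. x1 \<in> {0..1} \<Longrightarrow> x2 \<in> {0..1} \<Longrightarrow> 0 < x1 \<Longrightarrow> x1 < x2 \<Longrightarrow> x2 \<le> 2 * min \<delta> x1 \<Longrightarrow>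
        x2 / x1 \<le> q x2 / q x1 * (1 + c * q x1 powr \<theta>)"
    and c: "0 < c" and b: "0 < \<beta>" "\<beta> \<le> \<theta>" and e: "0 < \<epsilon>" "\<epsilon> \<le> 1"
    and K: "0 < K" and K': "K' = K / mu powr \<beta> + 2 * c" "\<epsilon> \<le> K' * (min \<delta> 1) powr \<beta>"
    and a: "0 \<le> a" "a \<le> b'" "b' \<le> 1" "(1 + \<epsilon>) * a - K * (a * a powr \<beta>) \<le> b'"
  shows "expansion \<epsilon> K' \<beta> (q a) \<le> q b'"
proof -
  have ab: "a \<in> {0..1}" "b' \<in> {0..1}" using a by auto
  have q01: "0 \<le> q x" "q x \<le> 1" if "x \<in> {0..1}" for x using that m(3) by auto
  have qab: "q a \<le> q b'" using mono_onD[OF m(1) ab a(2)] .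
  have K'0: "0 < K'" using K' K c mu by (auto intro!: add_pos_pos)
  define v where "v = q a"
  have v: "0 \<le> v" "v \<le> 1" using q01 ab by (auto simp: v_def)
  \<comment> \<open>At these levels the expansion is the identity and monotonicity of \<open>q\<close> suffices.\<close>
  have triv: "expansion \<epsilon> K' \<beta> v \<le> q b'" if "\<epsilon> \<le> K' * v powr \<beta>"
  proof -
    have "\<epsilon> * v \<le> K' * v powr \<beta> * v" using that v by (intro mult_right_mono)
    then show ?thesis using qab unfolding expansion_def v_def[symmetric] by (simp add: algebra_simps)
  qed
  consider "a = 0" | "min \<delta> 1 \<le> a" | "0 < a" "a < min \<delta> 1" using a by fastforce
  then show ?thesis
  proof cases
    case 1
    then show ?thesis using m q01[OF ab(2)] by (simp add: expansion_def)
  next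
    case 2
    have "min \<delta> 1 \<le> mu * min \<delta> 1" using mu \<delta> by simp
    also have "\<dots> \<le> q (min \<delta> 1)" using \<delta> by (intro lin) auto
    also have "\<dots> \<le> v" unfolding v_def using 2 \<delta> ab by (intro mono_onD[OF m(1)]) auto
    finally have "(min \<delta> 1) powr \<beta> \<le> v powr \<beta>" using \<delta> b by (intro powr_mono2) auto
    then have "K' * (min \<delta> 1) powr \<beta> \<le> K' * v powr \<beta>" using K'0 by (intro mult_left_mono) auto
    then show ?thesis using triv K' unfolding v_def by linarith
  next
    case 3
    have mv: "mu * a \<le> v" unfolding v_def using 3 ab by (intro lin) auto
    have "0 < mu * a" using 3 mu by simp
    then have v0: "0 < v" using mv by linarith
    have "a \<le> v / mu" using mv mu by (simp add: field_simps)
    then have "a powr \<beta> \<le> (v / mu) powr \<beta>" using 3 b by (intro powr_mono2) auto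
    also have "\<dots> = v powr \<beta> / mu powr \<beta>" using v mu by (simp add: powr_divide)
    finally have Ka: "K * a powr \<beta> \<le> K / mu powr \<beta> * v powr \<beta>"
      using K mult_left_mono[of "a powr \<beta>" "v powr \<beta> / mu powr \<beta>" K] by simp
    have vth: "v powr \<theta> \<le> v powr \<beta>" using v v0 b by (intro powr_mono') auto
    show ?thesis
    proof (cases "\<epsilon> \<le> K' * v powr \<beta>")
      case True
      then show ?thesis using triv by (simp add: v_def)
    next
      case False
      have "K / mu powr \<beta> * v powr \<beta> \<le> K' * v powr \<beta>" using K' c by (intro mult_right_mono) auto
      then have Kae: "K * a powr \<beta> < \<epsilon>" using Ka False by linarith
      define r where "r = 1 + \<epsilon> - K * a powr \<beta>"
      have "0 \<le> K * a powr \<beta>" using K by simp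
      then have r: "1 < r" "r \<le> 2" using Kae e unfolding r_def by linarith+
      have rab: "r * a \<le> b'" using a(4) by (simp add: r_def algebra_simps)
      \<comment> \<open>The ratio bound only reaches up to \<open>2a\<close>, so it is used at \<open>ra\<close> instead of \<open>b'\<close>.\<close>
      define x2 where "x2 = r * a"
      have x2: "a < x2" "x2 \<le> b'" "x2 \<le> 2 * a" using r 3 rab by (auto simp: x2_def)
      have "x2 / a \<le> q x2 / q a * (1 + c * q a powr \<theta>)"
        using x2 3 ab by (intro ratio) auto
      also have "x2 / a = r" using 3 by (simp add: x2_def)
      finally have "r * v \<le> q x2 * (1 + c * v powr \<theta>)"
        using v0 by (simp add: v_def field_simps)
      also have "\<dots> \<le> q b' * (1 + c * v powr \<theta>)"
        using x2 3 ab c by (intro mult_right_mono mono_onD[OF m(1)]) auto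
      finally have 1: "r * v \<le> q b' * (1 + c * v powr \<theta>)" .
      have "(r * v - 2 * c * v powr \<theta> * v) * (1 + c * v powr \<theta>) \<le> r * v"
      proof -
        define z where "z = c * v powr \<theta>"
        have z: "0 \<le> z" using c by (simp add: z_def)
        have "(r * v - 2 * z * v) * (1 + z) = r * v - (2 - r) * z * v - 2 * z\<^sup>2 * v"
          by (simp add: algebra_simps power2_eq_square)
        moreover have "0 \<le> (2 - r) * z * v" "0 \<le> 2 * z\<^sup>2 * v" using z r v by auto
        ultimately have "(r * v - 2 * z * v) * (1 + z) \<le> r * v" by linarith
        then show ?thesis unfolding z_def by (simp add: mult.assoc)
      qed
      then have "(r * v - 2 * c * v powr \<theta> * v) * (1 + c * v powr \<theta>) \<le> q b' * (1 + c * v powr \<theta>)"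
        using 1 by linarith
      moreover have "0 < 1 + c * v powr \<theta>" using c by (simp add: add_pos_nonneg)
      ultimately have 2: "r * v - 2 * c * v powr \<theta> * v \<le> q b'" by simp
      have "2 * c * v powr \<theta> * v \<le> 2 * c * v powr \<beta> * v"
        using vth c v by (intro mult_right_mono mult_left_mono) auto
      moreover have "K * a powr \<beta> * v \<le> K / mu powr \<beta> * v powr \<beta> * v"
        using Ka v by (intro mult_right_mono)
      ultimately have "(1 + \<epsilon>) * v - K' * (v * v powr \<beta>) \<le> q b'"
        using 2 unfolding r_def K'(1) by (simp add: algebra_simps)
      then show ?thesis using qab unfolding expansion_def v_def by simp
    qed
  qed
qed

text \<open>
  Suppose that the inequality fails at \<open>x\<close> for the new tail, and let \<open>U\<close> be the value of this tail at
  \<open>x\<close>. Then the value at \<open>x-d\<close> is below \<open>(1+\<epsilon>)U\<close>, and since (G3) makes it at least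
  \<open>(1-\<eta>) q(u(x-d))\<close>, the mass to the right of \<open>x-d\<close> is at most \<open>l = (1+\<epsilon>)U/(1-\<eta>)\<close>. With this
  \<open>l\<close>, with \<open>w = x-d\<close> and with \<open>\<kappa> = K U^\<beta>\<close>, the lemma \<open>shift_gains_mass\<close> contradicts the failure.
\<close>

lemma left_expanding_rec_op:
  fixes q u :: "real \<Rightarrow> real" and g :: "real \<Rightarrow> real \<Rightarrow> real"
  assumes u: "u \<in> tail_functions" and nf: "left_expanding \<epsilon> K \<beta> d u"
    and q: "mono_on {0..1} q" "q ` {0..1} = {0..1}" "q 0 = 0" "q 1 = 1"
    and tail: "\<And>a b. 0 \<le> a \<Longrightarrow> a \<le> b \<Longrightarrow> b \<le> 1 \<Longrightarrow> (1 + \<epsilon>) * a - K * (a * a powr \<beta>) \<le> b \<Longrightarrow>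
       expansion \<epsilon> K' \<beta> (q a) \<le> q b"
    and g: "\<And>y. g y \<in> tail_functions" "\<And>x. mono (\<lambda>y. g y (x - y))" "\<And>x. antimono (\<lambda>y. g y x)"
    and decay: "\<And>x y. 0 \<le> x \<Longrightarrow> A * g (y - d) (x + d) \<le> g y x"
    and g0: "\<And>y. 1 - \<eta> \<le> g y 0" and \<eta>: "0 \<le> \<eta>" "\<eta> < 1"
    and e: "0 < \<epsilon>" "\<epsilon> \<le> 1/6" "\<epsilon> \<le> K'" and b: "0 < \<beta>" "\<beta> \<le> 1" and A: "2 \<le> A" and d: "0 \<le> d"
    and K: "(1 + 6 * \<epsilon>) * K' * ((1 + \<epsilon>) / (1 - \<eta>)) powr \<beta> \<le> K"
  shows "left_expanding \<epsilon> K \<beta> d (rec_op q g u)"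
  unfolding left_expanding_def
proof (intro allI, rule ccontr)
  fix x
  define \<nu> where "\<nu> = interval_measure (\<lambda>y. - q (u y))"
  interpret real_distribution \<nu>
    unfolding \<nu>_def by (rule real_distribution_tail[OF u q])
  have \<nu>: "measure \<nu> {s<..} = q (u s)" for s unfolding \<nu>_def by (rule measure_tail[OF u q])
  note uD = tail_functionsD[OF u]
  note gD = tail_functionsD[OF g(1)]
  define h where "h = (\<lambda>y. g y (x - y))"
  define k where "k = (\<lambda>y. g y (x - d - y))"
  define U where "U = (\<integral>y. h y \<partial>\<nu>)"
  define V where "V = (\<integral>y. k y \<partial>\<nu>)"
  have U: "rec_op q g u x = U" and V: "rec_op q g u (x - d) = V"
    by (simp_all add: rec_op_def \<nu>_def U_def V_def h_def k_def)
  assume "\<not> (1 + \<epsilon>) * rec_op q g u x - K * (rec_op q g u x * rec_op q g u x powr \<beta>) \<le> rec_op q g u (x - d)"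
  then have less: "V < (1 + \<epsilon>) * U - K * (U * U powr \<beta>)" by (simp add: U V)
  have mono: "mono h" "mono k" unfolding h_def k_def using g(2) by auto
  have h01: "0 \<le> h y" "h y \<le> 1" and k01: "0 \<le> k y" "k y \<le> 1" for y
    using gD by (auto simp: h_def k_def)
  have [measurable]: "h \<in> borel_measurable borel" "k \<in> borel_measurable borel"
    using mono by (auto intro: borel_measurable_mono)
  have int: "integrable \<nu> h" "integrable \<nu> k"
    by (rule integrable_const_bound[where B=1]; use h01 k01 in simp)+
  have shift: "h (y + d) \<le> k y" for y
    using antimonoD[OF g(3), of y "y + d" "x - d - y"] d by (simp add: h_def k_def algebra_simps)
  have boost: "A * h y \<le> k y" if "y \<le> x - d" for y
  proof -
    have "g y (x - y) \<le> g (y - d) (x - y)" using antimonoD[OF g(3), of "y - d" y] d by simp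
    then have "A * h y \<le> A * g (y - d) (x - y)" using A by (simp add: h_def mult_left_mono)
    also have "\<dots> \<le> k y" using decay[of "x - d - y" y] that by (simp add: k_def)
    finally show ?thesis .
  qed
  have "h y \<le> k y" for y using monoD[OF mono(1), of y "y + d"] shift[of y] d by linarith
  then have UV: "U \<le> V" unfolding U_def V_def using int by (intro integral_mono) auto
  have U0: "0 \<le> U" unfolding U_def using h01 by simp
  have K'0: "0 < K'" using e by linarith
  have K0: "0 < K"
  proof -
    have "(0::real) < (1 + 6 * \<epsilon>) * K' * ((1 + \<epsilon>) / (1 - \<eta>)) powr \<beta>"
      using \<eta> e K'0 by (intro mult_pos_pos) auto
    then show ?thesis using K by linarith
  qed
  have "(1 - \<eta>) * q (u (x - d)) = (\<integral>y. (1 - \<eta>) * indicator {x - d<..} y \<partial>\<nu>)"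
    using \<nu>[of "x - d"] by simp
  also have "\<dots> \<le> V"
    unfolding V_def
  proof (rule integral_mono)
    show "integrable \<nu> (\<lambda>y. (1 - \<eta>) * indicator {x - d<..} y)"
      by (intro integrable_mult_right integrable_real_indicator) (auto simp: emeasure_eq_measure)
    show "(1 - \<eta>) * indicator {x - d<..} y \<le> k y" for y
      using antimonoD[OF gD(1), of "x - d - y" 0 y] g0[of y] k01[of y] by (auto simp: k_def indicator_def)
  qed (rule int)
  also have "V \<le> (1 + \<epsilon>) * U"
  proof -
    have "0 \<le> K * (U * U powr \<beta>)" using K0 U0 by simp
    then show ?thesis using less by linarith
  qed
  finally have w: "measure \<nu> {x - d<..} \<le> (1 + \<epsilon>) / (1 - \<eta>) * U"
    unfolding \<nu> using \<eta> by (simp add: field_simps)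
  \<comment> \<open>If \<open>K U^\<beta> > \<epsilon>\<close>, the claim at \<open>x\<close> is weaker than monotonicity.\<close>
  show False
  proof (cases "K * U powr \<beta> \<le> \<epsilon>")
    case False
    then have "\<epsilon> * U \<le> K * U powr \<beta> * U" using U0 by (intro mult_right_mono) auto
    then show False using less UV by (simp add: algebra_simps)
  next
    case True
    have "(1 + 6 * \<epsilon>) * K' * ((1 + \<epsilon>) / (1 - \<eta>) * U) powr \<beta>
        = (1 + 6 * \<epsilon>) * K' * ((1 + \<epsilon>) / (1 - \<eta>)) powr \<beta> * U powr \<beta>"
      using \<eta> e U0 by (subst powr_mult) auto
    also have "\<dots> \<le> K * U powr \<beta>" using K by (intro mult_right_mono) auto
    finally have kap: "(1 + 6 * \<epsilon>) * K' * ((1 + \<epsilon>) / (1 - \<eta>) * U) powr \<beta> \<le> K * U powr \<beta>" .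
    have "expansion \<epsilon> K' \<beta> (measure \<nu> {s<..}) \<le> measure \<nu> {s - d<..}" for s
      unfolding \<nu> using nf antimonoD[OF uD(1), of "s - d" s] uD d
      by (intro tail) (auto simp: left_expanding_def)
    from shift_gains_mass[OF mono(1) h01 mono(2) k01 shift boost this w e b A kap True]
    have "(1 + \<epsilon> - K * U powr \<beta>) * U \<le> V" by (simp add: U_def V_def)
    then show False using less by (simp add: algebra_simps)
  qed
qed

section \<open>Uniform expansion near zero along the recursion\<close>

text \<open>
  The factors lost in one step of the recursion, for \<open>\<epsilon>\<close> proportional to \<open>\<beta> log m\<close> and for
  the value of \<open>\<eta>\<close> in (G3), are smaller than the factor \<open>m^\<beta>\<close> won from \<open>Q\<^sub>n(x) \<ge> mx\<close>: half of
  the exponent is left over.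
\<close>

lemma drift_constants:
  fixes m :: real
  assumes m: "1 < m" "m \<le> 2" and b: "0 < \<beta>" "\<beta> \<le> 1"
    and \<epsilon>: "\<epsilon> = \<beta> * ln m / 36" and \<eta>: "\<eta> = ln m / 100"
  shows "(1 + 6 * \<epsilon>) * ((1 + \<epsilon>) / (1 - \<eta>)) powr \<beta> \<le> m powr (\<beta> / 2)"
proof -
  define L where "L = ln m"
  have "L \<le> m - 1" unfolding L_def using m by (intro ln_le_minus_one) auto
  moreover have "0 < L" using m by (simp add: L_def)
  ultimately have L: "0 < L" "L \<le> 1" using m by linarith+
  have \<epsilon>L: "\<epsilon> = \<beta> * L / 36" and \<eta>L: "\<eta> = L / 100" by (simp_all add: \<epsilon> \<eta> L_def)
  have e0: "0 < \<epsilon>" using b L by (simp add: \<epsilon>L)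
  have e1: "0 < \<eta>" "\<eta> \<le> 1/2" using L by (simp_all add: \<eta>L)
  have "1 + \<epsilon> \<le> exp \<epsilon>" by (rule exp_ge_add_one_self)
  moreover have "1 / (1 - \<eta>) \<le> exp (2 * \<eta>)"
  proof -
    have "\<eta> * \<eta> \<le> \<eta> * (1/2)" using e1 by (intro mult_left_mono) auto
    then have "1 \<le> (1 + 2 * \<eta>) * (1 - \<eta>)" by (simp add: algebra_simps)
    then have "1 / (1 - \<eta>) \<le> 1 + 2 * \<eta>" using e1 by (simp add: field_simps)
    also have "\<dots> \<le> exp (2 * \<eta>)" by (rule exp_ge_add_one_self)
    finally show ?thesis .
  qed
  ultimately have "(1 + \<epsilon>) * (1 / (1 - \<eta>)) \<le> exp \<epsilon> * exp (2 * \<eta>)"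
    using e0 e1 by (intro mult_mono) auto
  then have "((1 + \<epsilon>) / (1 - \<eta>)) powr \<beta> \<le> (exp (\<epsilon> + 2 * \<eta>)) powr \<beta>"
    using e0 e1 b by (intro powr_mono2) (auto simp: exp_add)
  also have "\<dots> = exp (\<beta> * (\<epsilon> + 2 * \<eta>))" by (simp add: powr_def)
  finally have "(1 + 6 * \<epsilon>) * ((1 + \<epsilon>) / (1 - \<eta>)) powr \<beta> \<le> exp (6 * \<epsilon>) * exp (\<beta> * (\<epsilon> + 2 * \<eta>))"
    using e0 by (intro mult_mono exp_ge_add_one_self) auto
  also have "\<dots> = exp (6 * \<epsilon> + \<beta> * (\<epsilon> + 2 * \<eta>))" by (simp add: exp_add)
  also have "\<dots> \<le> exp (\<beta> / 2 * L)"
  proof -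
    have "\<beta> * \<epsilon> \<le> 1 * \<epsilon>" using b e0 by (intro mult_right_mono) auto
    moreover have "0 < \<beta> * L" using b L by simp
    moreover have "6 * \<epsilon> + \<beta> * (\<epsilon> + 2 * \<eta>) = 6 * \<epsilon> + \<beta> * \<epsilon> + \<beta> * L / 50"
      by (simp add: \<eta>L algebra_simps)
    moreover have "\<beta> / 2 * L = \<beta> * L / 2" by simp
    ultimately have "6 * \<epsilon> + \<beta> * (\<epsilon> + 2 * \<eta>) \<le> \<beta> / 2 * L" using \<epsilon>L by linarith
    then show ?thesis by simp
  qed
  also have "\<dots> = m powr (\<beta> / 2)" using m by (simp add: powr_def L_def)
  finally show ?thesis .
qed

text \<open>
  The constants are chosen in the order \<open>\<beta>\<close>, \<open>d\<close>, \<open>\<epsilon>\<close>, \<open>K\<close>. One step replaces \<open>K\<close> by at most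
  \<open>r^(-1)(K r^2 + 2c)\<close> with \<open>r = m^(-\<beta>/2) < 1\<close>, by \<open>drift_constants\<close>, and this is at most \<open>K\<close> once \<open>K\<close> is
  large.
\<close>

lemma left_expanding_along_recursion:
  fixes m :: real and Q :: "nat \<Rightarrow> real \<Rightarrow> real" and G :: "nat \<Rightarrow> real \<Rightarrow> real \<Rightarrow> real" and u :: "nat \<Rightarrow> real \<Rightarrow> real"
  assumes Q_onto: "\<And>n. Q n ` {0..1} = {0..1}"
    and G_tail: "\<And>n y. G n y \<in> tail_functions"
    and A: "assumption_A m Q" and B: "assumption_B m G"
    and u: "\<And>n. u n \<in> tail_functions"
    and u0: "u 0 = (\<lambda>x. if 0 \<le> x then 0 else 1)"
    and uSuc: "\<And>n. u (Suc n) = rec_op (Q n) (G n) (u n)"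
  obtains \<epsilon> K \<beta> d where "0 < \<epsilon>" "0 < K" "0 < \<beta>" "0 < d" "\<And>n. left_expanding \<epsilon> K \<beta> d (u n)"
proof -
  have m: "1 < m" "m \<le> 2" and Qm: "\<And>n. mono_on {0..1} (Q n)" "\<And>n. Q n 0 = 0" "\<And>n. Q n 1 = 1"
    using A by (auto simp: assumption_A_def)
  obtain \<delta> c \<theta> where pos: "0 < \<delta>" "0 < c" "0 < \<theta>"
    and lin: "\<And>n x. x \<in> {0..1} \<Longrightarrow> x \<le> 2 * \<delta> \<Longrightarrow> m * x \<le> Q n x"
    and ratio: "\<And>n x1 x2. x1 \<in> {0..1} \<Longrightarrow> x2 \<in> {0..1} \<Longrightarrow> 0 < x1 \<Longrightarrow> x1 < x2 \<Longrightarrow> x2 \<le> 2 * min \<delta> x1 \<Longrightarrow>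
        x2 / x1 \<le> Q n x2 / Q n x1 * (1 + c * Q n x1 powr \<theta>)"
    using A unfolding assumption_A_def by metis
  have G1: "\<And>n x. mono (\<lambda>y. G n y (x - y))" "\<And>n x. antimono (\<lambda>y. G n y x)"
    and G3: "\<And>n y. 1 - ln m / 100 \<le> G n y 0"
    using B by (auto simp: assumption_B_def)
  obtain a M0 where a: "0 < a" "0 < M0"
    and G2: "\<And>n x y M. 0 \<le> x \<Longrightarrow> M0 \<le> M \<Longrightarrow> G n (y - M) (x + M) \<le> exp (- a * M) * G n y x"
    using B unfolding assumption_B_def by (metis greaterThanLessThan_iff)
  define \<beta> where "\<beta> = min \<theta> 1"
  define \<epsilon> where "\<epsilon> = \<beta> * ln m / 36"
  define \<eta> where "\<eta> = ln m / 100"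
  define d where "d = max M0 (1 / a)"
  define r where "r = m powr (- \<beta> / 2)"
  define D where "D = (min \<delta> 1) powr \<beta>"
  \<comment> \<open>The first summand gives \<open>r^(-1)(K r^2 + 2c) \<le> K\<close>. The second one makes the expansion trivial at
    all levels above \<open>min(\<delta>,1)\<close>, where the ratio bound of Assumption A no longer reaches up to a
    factor \<open>2\<close>. The third one covers the
    initial tail, which only takes the values \<open>0\<close> and \<open>1\<close>.\<close>
  define K where "K = 2 * c / (r * (1 - r)) + \<epsilon> / (r\<^sup>2 * D) + 1"
  define K' where "K' = K / m powr \<beta> + 2 * c"
  have b: "0 < \<beta>" "\<beta> \<le> 1" "\<beta> \<le> \<theta>" using pos by (auto simp: \<beta>_def)
  have lnm: "0 < ln m" "ln m \<le> 1" using m ln_le_minus_one[of m] by auto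
  have "\<beta> * ln m \<le> 1 * 1" using b lnm by (intro mult_mono) auto
  then have e: "0 < \<epsilon>" "\<epsilon> \<le> 1/6" using b lnm by (auto simp: \<epsilon>_def)
  have \<eta>: "0 \<le> \<eta>" "\<eta> < 1" using lnm by (auto simp: \<eta>_def)
  have d: "0 < d" using a by (auto simp: d_def)
  have r: "0 < r" "r < 1" using m b unfolding r_def by (auto simp: powr_less_one)
  have r2: "1 / m powr \<beta> = r\<^sup>2"
    using m by (simp add: r_def power2_eq_square powr_add[symmetric] powr_minus_divide)
  have r1: "m powr (\<beta> / 2) = 1 / r" using m by (simp add: r_def powr_minus_divide)
  have D: "0 < D" "D \<le> 1" using pos b by (auto simp: D_def intro!: powr_le1)
  have K: "0 < K" "2 * c / (r * (1 - r)) \<le> K" "\<epsilon> / (r\<^sup>2 * D) \<le> K" "1 \<le> K"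
    unfolding K_def using r D pos e by (auto intro!: add_pos_pos)
  have K'eq: "K' = K * r\<^sup>2 + 2 * c" unfolding K'_def r2[symmetric] by simp
  have "\<epsilon> \<le> K * r\<^sup>2 * D" using K(3) r D by (simp add: field_simps)
  also have "\<dots> \<le> K' * D" using K'eq pos D by (intro mult_right_mono) auto
  finally have eK'D: "\<epsilon> \<le> K' * D" .
  have K'0: "0 < K'" unfolding K'eq using K r pos by (auto intro!: add_pos_pos)
  have eK': "\<epsilon> \<le> K'" using eK'D D K'0 mult_left_mono[of D 1 K'] by linarith
  have Kcond: "(1 + 6 * \<epsilon>) * K' * ((1 + \<epsilon>) / (1 - \<eta>)) powr \<beta> \<le> K"
  proof -
    have "(1 + 6 * \<epsilon>) * K' * ((1 + \<epsilon>) / (1 - \<eta>)) powr \<beta>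
        = ((1 + 6 * \<epsilon>) * ((1 + \<epsilon>) / (1 - \<eta>)) powr \<beta>) * K'" by simp
    also have "\<dots> \<le> (1 / r) * K'"
      using drift_constants[OF m b(1,2) \<epsilon>_def \<eta>_def] K'0 r1 by (intro mult_right_mono) auto
    also have "\<dots> = K * r + 2 * c / r" using r by (simp add: K'eq field_simps power2_eq_square)
    also have "\<dots> \<le> K"
    proof -
      have "2 * c \<le> K * (r * (1 - r))" using K(2) r by (simp add: pos_divide_le_eq)
      then have "2 * c / r \<le> K * (1 - r)" using r by (simp add: pos_divide_le_eq mult_ac)
      then show ?thesis by (simp add: algebra_simps)
    qed
    finally show ?thesis .
  qed
  have decay: "2 * G n (y - d) (x + d) \<le> G n y x" if "0 \<le> x" for n x y
  proof -
    have "1 \<le> a * d" using a by (auto simp: d_def max_def field_simps)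
    then have "2 \<le> exp (a * d)" using exp_ge_add_one_self[of "a * d"] by linarith
    then have "2 * G n (y - d) (x + d) \<le> exp (a * d) * G n (y - d) (x + d)"
      using tail_functionsD(2)[OF G_tail] by (intro mult_right_mono)
    also have "\<dots> \<le> exp (a * d) * (exp (- a * d) * G n y x)"
      using G2[OF that, of d n y] by (intro mult_left_mono) (auto simp: d_def)
    also have "\<dots> = G n y x" by (simp add: mult.assoc[symmetric] exp_add[symmetric])
    finally show ?thesis .
  qed
  have "left_expanding \<epsilon> K \<beta> d (u n)" for n
  proof (induction n)
    case 0
    show ?case using K e d by (auto simp: left_expanding_def u0)
  next
    case (Suc n)
    have grow: "expansion \<epsilon> K' \<beta> (Q n x) \<le> Q n y"
      if "0 \<le> x" "x \<le> y" "y \<le> 1" "(1 + \<epsilon>) * x - K * (x * x powr \<beta>) \<le> y" for x y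
    proof (rule expansion_transform[OF Qm(1,2) Q_onto lin _ pos(1) ratio pos(2) b(1,3) e(1) _ K(1) K'_def _ that])
      show "1 \<le> m" "\<epsilon> \<le> 1" "\<epsilon> \<le> K' * (min \<delta> 1) powr \<beta>" using m e eK'D by (auto simp: D_def)
    qed
    have "\<And>y. 1 - \<eta> \<le> G n y 0" using G3 by (simp add: \<eta>_def)
    from left_expanding_rec_op[OF u Suc.IH Qm(1) Q_onto Qm(2,3) grow G_tail G1 decay this \<eta> e eK' b(1,2) order_refl _ Kcond]
    show ?case using d by (simp add: uSuc)
  qed
  then show ?thesis using that e K b d by blast
qed

section \<open>Absence of flat stretches at all levels\<close>

text \<open>
  Condition (T2) read backwards: if the values of \<open>q\<close> at \<open>x\<close> and \<open>y\<close> are nearly equal, then so are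
  \<open>x\<close> and \<open>y\<close>. The cut-off of \<open>q\<close> beyond \<open>1\<close> disappears because \<open>(1+g(\<epsilon>'))x < y \<le> 1\<close>.
\<close>

lemma Q_tilde_class_unflat:
  assumes "q \<in> Q_tilde_class" "0 < \<delta>" "\<delta> < 1" "0 < \<epsilon>" "0 < s"
  obtains \<epsilon>' where "0 < \<epsilon>'" "\<epsilon>' \<le> s"
    "\<And>x y. \<delta> \<le> x \<Longrightarrow> y \<le> 1 \<Longrightarrow> (1 + \<epsilon>) * x < y \<Longrightarrow> q x \<le> (1 - \<delta>) / (1 + \<epsilon>') \<Longrightarrow> (1 + \<epsilon>') * q x \<le> q y"
proof -
  have sm: "strict_mono_on {0..1} q" using assms(1) by (simp add: Q_tilde_class_def)
  have "\<forall>\<delta>\<in>{0<..<1}. \<exists>g. (\<forall>\<epsilon>>0. g \<epsilon> \<ge> 0) \<and> (g \<longlongrightarrow> 0) (at_right (0::real)) \<and>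
            (\<forall>\<epsilon>>0. \<forall>x\<in>{0..1}. x \<ge> \<delta> \<and> q x \<le> (1 - \<delta>) / (1 + \<epsilon>) \<longrightarrow>
               (let z = (1 + g \<epsilon>) * x in if z > 1 then 1 else q z) \<ge> (1 + \<epsilon>) * q x)"
    using assms(1) unfolding Q_tilde_class_def by simp
  from bspec[OF this, of \<delta>] assms(2,3) obtain g where g: "\<forall>\<epsilon>>0. 0 \<le> g \<epsilon>" "(g \<longlongrightarrow> 0) (at_right (0::real))"
    and T2: "\<forall>\<epsilon>>0. \<forall>x\<in>{0..1}. x \<ge> \<delta> \<and> q x \<le> (1 - \<delta>) / (1 + \<epsilon>) \<longrightarrow>
       (let z = (1 + g \<epsilon>) * x in if z > 1 then 1 else q z) \<ge> (1 + \<epsilon>) * q x"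
    by auto
  have "eventually (\<lambda>e. g e < \<epsilon>) (at_right 0)" using order_tendstoD(2)[OF g(2) assms(4)] .
  moreover have "eventually (\<lambda>e. e \<in> {0<..<s}) (at_right 0)"
    using assms(5) by (rule eventually_at_right_real)
  ultimately have "eventually (\<lambda>e. g e < \<epsilon> \<and> e \<in> {0<..<s}) (at_right 0)" by eventually_elim simp
  then obtain e where e: "g e < \<epsilon>" "0 < e" "e < s"
    using eventually_happens'[of "at_right (0::real)"] by (auto simp: trivial_limit_at_right_real)
  show ?thesis
  proof (rule that[of e])
    fix x y assume x: "\<delta> \<le> x" "y \<le> 1" "(1 + \<epsilon>) * x < y" "q x \<le> (1 - \<delta>) / (1 + e)"
    have x0: "0 < x" using x assms by linarith
    have z: "x \<le> (1 + g e) * x" "(1 + g e) * x \<le> (1 + \<epsilon>) * x"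
      using x0 e g(1) by (auto simp: algebra_simps)
    have "(1 + e) * q x \<le> (let z = (1 + g e) * x in if z > 1 then 1 else q z)"
    proof -
      have "x \<le> 1" using z x by linarith
      then have "x \<in> {0..1}" using x0 by simp
      then show ?thesis using T2 e(2) x(1,4) by blast
    qed
    then have "(1 + e) * q x \<le> q ((1 + g e) * x)" using z x by (simp add: Let_def)
    also have "\<dots> \<le> q y"
      using strict_mono_onD[OF sm, of "(1 + g e) * x" y] z x x0 by simp
    finally show "(1 + e) * q x \<le> q y" .
  qed (use e in auto)
qed

text \<open>
  Induction on \<open>k\<close> excludes flat stretches that start at a level at most \<open>\<delta>\<^sub>1 c^k\<close>, and for large
  \<open>k\<close> this is no restriction. The case \<open>k = 0\<close> is the expansion near zero. In the step, a flat stretch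
  of \<open>u\<^sub>n\<^sub>+\<^sub>1\<close> that starts at a level between \<open>\<delta>\<^sub>1\<close> and \<open>\<delta>\<^sub>1 c^(k+1)\<close> yields a flat stretch of
  \<open>u\<^sub>n\<close> that is shorter by \<open>2B\<close> and starts at a level at most \<open>\<delta>\<^sub>1 c^k\<close>. Here \<open>c\<close> is the square
  root of the factor in (T1), so that one factor \<open>c\<close> can be spent on the error \<open>\<eta>\<close> in
  Assumption C.
\<close>

lemma ratio_gap:
  fixes u :: "nat \<Rightarrow> real \<Rightarrow> real"
  assumes u: "\<And>n. u n \<in> tail_functions" and u0: "\<And>x. u 0 x \<in> {0, 1}"
    and q: "q \<in> Q_tilde_class"
    and C: "\<And>\<eta>. 0 < \<eta> \<Longrightarrow> \<exists>B\<ge>0. \<forall>n x. q (u n (x + B)) - \<eta> \<le> u (Suc n) x \<and> u (Suc n) x \<le> q (u n (x - B)) + \<eta>"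
    and base: "\<And>n y. u n y \<le> \<delta>1 \<Longrightarrow> (1 + \<epsilon>1) * u n y \<le> u n (y - d)"
    and pos: "0 < \<delta>1" "0 < \<epsilon>1" "0 < d" and \<delta>: "0 < \<delta>" "\<delta> < 1"
  obtains l \<epsilon> where "0 < l" "0 < \<epsilon>"
    "\<And>n a b. l \<le> b - a \<Longrightarrow> u n a \<le> 1 - \<delta> \<Longrightarrow> 0 < u n b \<Longrightarrow> (1 + \<epsilon>) * u n b < u n a"
proof -
  have q01: "q 0 = 0" "q 1 = 1" and qsm: "strict_mono_on {0..1} q" and qc: "continuous_on {0..1} q"
    and qgt: "\<And>x. x \<in> {0<..<1} \<Longrightarrow> x < q x"
    using q by (auto simp: Q_tilde_class_def)
  have qge: "x \<le> q x" if "0 \<le> x" "x \<le> 1" for x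
    using qgt[of x] q01 that by (cases "x = 0 \<or> x = 1") (auto simp: less_imp_le)
  note uD = tail_functionsD[OF u]
  have um: "u n y \<le> u n x" if "x \<le> y" for n x y using antimonoD[OF uD(1) that] .
  obtain c2 where c2: "1 < c2" "\<And>x. 0 < x \<Longrightarrow> x \<le> 1 - \<delta> / 2 \<Longrightarrow> c2 * x < q x"
  proof -
    have "\<forall>\<delta>>0. \<exists>c>1. \<forall>x. 0 < x \<and> x \<le> 1 - \<delta> \<longrightarrow> q x > c * x" using q by (simp add: Q_tilde_class_def)
    then have "\<exists>c>1. \<forall>x. 0 < x \<and> x \<le> 1 - \<delta>/2 \<longrightarrow> q x > c * x" using \<delta> by simp
    then show ?thesis using that by blast
  qed
  define c where "c = sqrt c2"
  have c: "1 < c" "c * c = c2" using c2(1) by (auto simp: c_def)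
  have near0: "(1 + \<epsilon>1 / 2) * u n b < u n a"
    if "d \<le> b - a" "u n a \<le> \<delta>1" "0 < u n b" for n a b
  proof -
    have "u n b \<le> \<delta>1" using um[of a b n] that pos by linarith
    then have "(1 + \<epsilon>1) * u n b \<le> u n (b - d)" by (rule base)
    also have "\<dots> \<le> u n a" using that by (intro um) auto
    finally have "(1 + \<epsilon>1) * u n b \<le> u n a" .
    moreover have "(1 + \<epsilon>1 / 2) * u n b < (1 + \<epsilon>1) * u n b" using that pos by (intro mult_strict_right_mono) auto
    ultimately show ?thesis by linarith
  qed
  have claim: "\<exists>l>0. \<exists>\<epsilon>>0. \<forall>n a b. l \<le> b - a \<longrightarrow> u n a \<le> 1 - \<delta> \<longrightarrow> u n a \<le> \<delta>1 * c ^ k \<longrightarrow> 0 < u n b \<longrightarrow>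
      (1 + \<epsilon>) * u n b < u n a" for k
  proof (induction k)
    case 0
    show ?case
      by (rule exI[of _ d], intro conjI pos, rule exI[of _ "\<epsilon>1 / 2"]) (use near0 pos in auto)
  next
    case (Suc k)
    then obtain l \<epsilon> where l: "0 < l" "0 < \<epsilon>"
      and IH: "\<And>n a b. l \<le> b - a \<Longrightarrow> u n a \<le> 1 - \<delta> \<Longrightarrow> u n a \<le> \<delta>1 * c ^ k \<Longrightarrow> 0 < u n b \<Longrightarrow> (1 + \<epsilon>) * u n b < u n a"
      by blast
    \<comment> \<open>Values of \<open>Q~\<close> above \<open>\<delta>\<^sub>1/4\<close> come from arguments above \<open>low\<close>; this is the lower
      cut-off that (T2) needs.\<close>
    obtain low where low: "0 < low" "low < 1" "q low \<le> \<delta>1 / 4"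
    proof -
      define t where "t = min (\<delta>1 / 4) (1 / 2)"
      have t: "0 < t" "t < 1" "t \<le> \<delta>1 / 4" using pos by (auto simp: t_def)
      have "\<exists>x\<ge>0. x \<le> 1 \<and> q x = t" using IVT'[of q 0 t 1] q01 t qc by auto
      then obtain x where x: "0 \<le> x" "x \<le> 1" "q x = t" by blast
      then have "x \<noteq> 0" "x \<noteq> 1" using q01 t by auto
      then show ?thesis using that[of x] x t by simp
    qed
    define \<delta>2 where "\<delta>2 = min low (\<delta> / 4)"
    have \<delta>2: "0 < \<delta>2" "\<delta>2 < 1" "\<delta>2 \<le> low" "\<delta>2 \<le> \<delta> / 4" using low \<delta> by (auto simp: \<delta>2_def)
    have "0 < \<delta> / 4" using \<delta> by simp
    then obtain e where e: "0 < e" "e \<le> \<delta> / 4"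
      and T2: "\<And>x y. \<delta>2 \<le> x \<Longrightarrow> y \<le> 1 \<Longrightarrow> (1 + \<epsilon>) * x < y \<Longrightarrow> q x \<le> (1 - \<delta>2) / (1 + e) \<Longrightarrow> (1 + e) * q x \<le> q y"
      using Q_tilde_class_unflat[OF q \<delta>2(1,2) l(2)] by metis
    \<comment> \<open>The three bounds keep the levels away from \<open>1\<close>, keep the relative error below the gap
      \<open>e\<close> at levels above \<open>\<delta>\<^sub>1/2\<close>, and keep the level dropping by the factor \<open>c\<close>.\<close>
    define \<eta> where "\<eta> = min (\<delta> / 2) (min (e * \<delta>1 / 12) (\<delta>1 * (c - 1)))"
    have \<eta>: "0 < \<eta>" "\<eta> \<le> \<delta> / 2" "\<eta> \<le> e * \<delta>1 / 12" "\<eta> \<le> \<delta>1 * (c - 1)"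
      using \<delta> e pos c by (auto simp: \<eta>_def)
    from C[OF \<eta>(1)] obtain B where B: "0 \<le> B"
      and CB: "\<And>n x. q (u n (x + B)) - \<eta> \<le> u (Suc n) x" "\<And>n x. u (Suc n) x \<le> q (u n (x - B)) + \<eta>"
      by blast
    define l' where "l' = max (l + 2 * B) d"
    define e' where "e' = min (e / 4) (\<epsilon>1 / 2)"
    have e': "0 < e'" "e' \<le> e / 4" "e' \<le> \<epsilon>1 / 2" "e' \<le> 1" using e pos \<delta> by (auto simp: e'_def)
    have "(1 + e') * u n b < u n a"
      if ab: "l' \<le> b - a" and ua: "u n a \<le> 1 - \<delta>" "u n a \<le> \<delta>1 * c ^ Suc k" and ub: "0 < u n b" for n a b
    proof (cases "u n a \<le> \<delta>1")
      case True
      have "(1 + \<epsilon>1 / 2) * u n b < u n a" using ab True ub by (intro near0) (auto simp: l'_def)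
      moreover have "(1 + e') * u n b \<le> (1 + \<epsilon>1 / 2) * u n b" using e' ub by (intro mult_right_mono) auto
      ultimately show ?thesis by linarith
    next
      case False
      show ?thesis
      proof (rule ccontr)
        assume "\<not> (1 + e') * u n b < u n a"
        then have flat: "u n a \<le> (1 + e') * u n b" by simp
        have "(1 + e') * u n b \<le> 2 * u n b" using e' ub by (intro mult_right_mono) auto
        then have ub2: "\<delta>1 / 2 \<le> u n b" using flat False by linarith
        have "n \<noteq> 0"
        proof
          assume "n = 0"
          then show False using u0[of a] False ua(1) pos \<delta> by auto
        qed
        then obtain n' where n: "n = Suc n'" by (cases n) auto
        define X where "X = u n' (a + B)"
        define Y where "Y = u n' (b - B)"
        have XY01: "0 \<le> X" "X \<le> 1" "0 \<le> Y" "Y \<le> 1" using uD by (auto simp: X_def Y_def)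
        have ab': "l \<le> (b - B) - (a + B)" using ab by (simp add: l'_def)
        have YX: "Y \<le> X" unfolding X_def Y_def using ab' l by (intro um) auto
        have qX: "q X \<le> u n a + \<eta>" using CB(1)[of n' a] by (simp add: n X_def)
        have qY: "u n b - \<eta> \<le> q Y" using CB(2)[of n' b] by (simp add: n Y_def)
        have "e * \<delta>1 \<le> 1 * \<delta>1" using e \<delta> pos by (intro mult_right_mono) auto
        then have qY4: "\<delta>1 / 4 < q Y" using qY ub2 \<eta>(3) pos by linarith
        have lowY: "low \<le> Y"
        proof (rule ccontr)
          assume "\<not> low \<le> Y"
          then have "q Y < q low" using XY01 low by (intro strict_mono_onD[OF qsm]) auto
          then show False using low qY4 by linarith
        qed
        have X0: "0 < X" using lowY low YX by linarith
        have X2: "X \<le> 1 - \<delta> / 2" using qge[of X] XY01 qX ua \<eta>(2) by linarith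
        have "c * (c * X) = c2 * X" using c(2) by (simp add: mult.assoc[symmetric])
        also have "\<dots> < q X" using c2(2)[OF X0 X2] .
        also have "\<dots> \<le> u n a + \<delta>1 * (c - 1)" using qX \<eta> by linarith
        also have "\<dots> \<le> u n a + u n a * (c - 1)" using False c by simp
        also have "\<dots> = c * u n a" by (simp add: algebra_simps)
        finally have cX: "c * X < u n a" using c by simp
        have "1 * X \<le> c * X" using c X0 by (intro mult_right_mono) auto
        then have "X \<le> 1 - \<delta>" using cX ua by linarith
        moreover have "X \<le> \<delta>1 * c ^ k"
        proof -
          have "c * X \<le> c * (\<delta>1 * c ^ k)" using cX ua(2) by (simp add: mult_ac)
          then show ?thesis using c by simp
        qed
        ultimately have gap: "(1 + \<epsilon>) * Y < X"
          unfolding X_def Y_def using lowY low by (intro IH ab') (auto simp: Y_def)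
        have "q Y \<le> q X" using strict_mono_onD[OF qsm, of Y X] XY01 YX by (cases "X = Y") auto
        also have "\<dots> \<le> 1 - \<delta> / 2" using qX ua \<eta>(2) by linarith
        also have "\<dots> \<le> (1 - \<delta>2) / (1 + e)"
        proof -
          have "(1 - \<delta> / 2) * e \<le> 1 * (\<delta> / 4)" using e \<delta> by (intro mult_mono) auto
          then have "(1 - \<delta> / 2) * (1 + e) \<le> 1 - \<delta>2" using \<delta>2(4) by (simp add: algebra_simps)
          then show ?thesis using e by (simp add: pos_le_divide_eq)
        qed
        finally have "(1 + e) * q Y \<le> q X" using T2[of Y X] lowY \<delta>2 XY01 gap by auto
        then have "(1 + e) * (u n b - \<eta>) \<le> u n a + \<eta>"
          using qX mult_left_mono[OF qY, of "1 + e"] e by linarith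
        moreover have "(1 + e') * u n b \<le> (1 + e / 4) * u n b" using e' ub by (intro mult_right_mono) auto
        ultimately have "3 / 4 * (e * u n b) \<le> 2 * \<eta> + e * \<eta>" using flat by (simp add: algebra_simps)
        moreover have "e * (\<delta>1 / 2) \<le> e * u n b" using ub2 e by (intro mult_left_mono) auto
        moreover have "e * \<eta> \<le> 1 * \<eta>" using e \<delta> \<eta> by (intro mult_right_mono) auto
        moreover have "0 < e * \<delta>1" using e pos by simp
        ultimately show False using \<eta>(3) by linarith
      qed
    qed
    moreover have "0 < l'" using pos by (auto simp: l'_def)
    ultimately show ?case using e'(1) by blast
  qed
  obtain k where k: "1 / \<delta>1 < c ^ k" using real_arch_pow[OF c(1)] by blast
  have "1 \<le> \<delta>1 * c ^ k" using k pos by (simp add: field_simps)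
  then have top: "u n a \<le> \<delta>1 * c ^ k" for n a using uD(3)[of n a] by linarith
  from claim[of k] obtain l \<epsilon> where "0 < l" "0 < \<epsilon>"
    "\<And>n a b. l \<le> b - a \<Longrightarrow> u n a \<le> 1 - \<delta> \<Longrightarrow> u n a \<le> \<delta>1 * c ^ k \<Longrightarrow> 0 < u n b \<Longrightarrow> (1 + \<epsilon>) * u n b < u n a"
    by blast
  then show ?thesis using that top by blast
qed

section \<open>Tightness around the median\<close>

lemma distribution_function_shift:
  assumes "distribution_function H"
  shows "distribution_function (\<lambda>x. H (x + c))"
proof -
  have "filterlim (\<lambda>x. x + c) (at_right (x + c)) (at_right x)" for x :: real
    by (auto simp: filterlim_at eventually_at_filter intro!: tendsto_eq_intros)
  then have "continuous (at_right x) (\<lambda>x. H (x + c))" for x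
    using assms filterlim_compose[of H "nhds (H (x + c))" "at_right (x + c)" "\<lambda>x. x + c" "at_right x"]
    by (simp add: distribution_function_def continuous_within)
  moreover have "filterlim (\<lambda>x. x + c) at_top at_top"
    using filterlim_tendsto_add_at_top[OF tendsto_const[of c] filterlim_ident] by (simp add: add.commute)
  moreover have "filterlim (\<lambda>x. x + c) at_bot at_bot"
  proof (subst filterlim_at_bot, intro allI)
    show "eventually (\<lambda>x. x + c \<le> Z) at_bot" for Z
      unfolding eventually_at_bot_linorder by (intro exI[of _ "Z - c"]) auto
  qed
  ultimately show ?thesis
    using assms unfolding distribution_function_def
    by (auto simp: mono_def intro: filterlim_compose)
qed

lemma tail_at_Med:
  assumes "u \<in> tail_functions"
  shows "u (Med (\<lambda>x. 1 - u x)) \<le> 1/2" "\<And>x. x < Med (\<lambda>x. 1 - u x) \<Longrightarrow> 1/2 < u x"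
proof -
  note u = tail_functionsD[OF assms]
  define S where "S = {x. u x \<le> 1/2}"
  have Med: "Med (\<lambda>x. 1 - u x) = Inf S" unfolding Med_def S_def by (intro arg_cong[of _ _ Inf]) auto
  have "eventually (\<lambda>x. u x < 1/2) at_top" by (rule order_tendstoD(2)[OF u(6)]) simp
  then obtain b where b: "u b < 1/2" by (auto simp: eventually_at_top_linorder)
  then have ne: "S \<noteq> {}" by (auto simp: S_def intro: less_imp_le)
  have "eventually (\<lambda>x. 1/2 < u x) at_bot" by (rule order_tendstoD(1)[OF u(5)]) simp
  then obtain a where a: "1/2 < u a" by (auto simp: eventually_at_bot_linorder)
  have bdd: "bdd_below S"
  proof (rule bdd_belowI[of _ a])
    show "a \<le> x" if "x \<in> S" for x
      using that a antimonoD[OF u(1), of x a] by (cases "a \<le> x") (auto simp: S_def)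
  qed
  show "1/2 < u x" if "x < Med (\<lambda>x. 1 - u x)" for x
    using that cInf_lower[OF _ bdd, of x] unfolding Med by (force simp: S_def)
  have "u x \<le> 1/2" if "Inf S < x" for x
  proof -
    obtain y where "y \<in> S" "y < x" using cInf_lessD[OF ne \<open>Inf S < x\<close>] by blast
    then show ?thesis using antimonoD[OF u(1), of y x] by (simp add: S_def)
  qed
  then have "eventually (\<lambda>x. u x \<le> 1/2) (at_right (Inf S))" by (auto simp: eventually_at_filter)
  then show "u (Med (\<lambda>x. 1 - u x)) \<le> 1/2" unfolding Med by (intro tendsto_upperbound[OF u(4)]) auto
qed

text \<open>
  From any point where \<open>u\<^sub>n \<le> 1-\<delta>\<close>, the tail decays geometrically in steps of length \<open>l\<close>. Starting
  at the median this bounds the right tail. If the tail were at most \<open>1-\<delta>\<close> at a point more than \<open>j\<close>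
  steps to the left of the median, then it would fall below \<open>1/2\<close> before the median.
\<close>

lemma tight_if_ratio_gap:
  fixes u :: "nat \<Rightarrow> real \<Rightarrow> real"
  assumes u: "\<And>n. u n \<in> tail_functions"
    and gap: "\<And>\<delta>. 0 < \<delta> \<Longrightarrow> \<delta> < 1 \<Longrightarrow> \<exists>l>0. \<exists>\<epsilon>>0. \<forall>n a b. l \<le> b - a \<longrightarrow> u n a \<le> 1 - \<delta> \<longrightarrow> 0 < u n b \<longrightarrow> (1 + \<epsilon>) * u n b < u n a"
  shows "tight_dfs (\<lambda>n x. 1 - u n (x + Med (\<lambda>x. 1 - u n x)))"
  unfolding tight_dfs_def
proof (intro conjI allI impI)
  note uD = tail_functionsD[OF u]
  have um: "u n y \<le> u n x" if "x \<le> y" for n x y using antimonoD[OF uD(1) that] .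
  show "distribution_function (\<lambda>x. 1 - u n (x + Med (\<lambda>x. 1 - u n x)))" for n
    using u[of n] distribution_function_shift[of "\<lambda>x. 1 - u n x"] by (simp add: tail_functions_def)
  fix \<epsilon> :: real assume "0 < \<epsilon>"
  define \<delta> where "\<delta> = min (\<epsilon> / 2) (1 / 2)"
  have \<delta>: "0 < \<delta>" "\<delta> \<le> 1/2" "2 * \<delta> \<le> \<epsilon>" using \<open>0 < \<epsilon>\<close> by (auto simp: \<delta>_def)
  obtain l e where l: "0 < l" "0 < e"
    and gap: "\<And>n a b. l \<le> b - a \<Longrightarrow> u n a \<le> 1 - \<delta> \<Longrightarrow> 0 < u n b \<Longrightarrow> (1 + e) * u n b < u n a"
    using gap[of \<delta>] \<delta> by auto
  have decay: "u n (a + real j * l) \<le> (1 / (1 + e)) ^ j" if a: "u n a \<le> 1 - \<delta>" for n a j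
  proof (induction j)
    case 0 then show ?case using uD(3) by simp
  next
    case (Suc j)
    let ?b = "a + real (Suc j) * l" and ?a = "a + real j * l"
    show ?case
    proof (cases "0 < u n ?b")
      case True
      have "u n ?a \<le> 1 - \<delta>" using um[of a ?a n] a l by (auto intro: order_trans)
      then have "(1 + e) * u n ?b < u n ?a" using True by (intro gap) (auto simp: algebra_simps)
      also have "\<dots> \<le> (1 / (1 + e)) ^ j" by (rule Suc.IH)
      finally have "u n ?b < (1 / (1 + e)) ^ j / (1 + e)" using l by (simp add: pos_less_divide_eq mult.commute)
      then show ?thesis by simp
    next
      case False
      moreover have "0 \<le> (1 / (1 + e)) ^ Suc j" using l by simp
      ultimately show ?thesis by linarith
    qed
  qed
  have "1 / (1 + e) < 1" using l by simp
  then obtain j where j: "(1 / (1 + e)) ^ j < \<delta>" using real_arch_pow_inv[OF \<delta>(1)] by blast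
  show "\<exists>A>0. \<forall>n. 1 - u n (A + Med (\<lambda>x. 1 - u n x)) - (1 - u n (- A + Med (\<lambda>x. 1 - u n x))) > 1 - \<epsilon>"
  proof (intro exI conjI allI)
    \<comment> \<open>One step beyond \<open>j\<close>, since the tail exceeds \<open>1/2\<close> only strictly to the left of the median.\<close>
    define A where "A = (real j + 1) * l"
    show "0 < (real j + 1) * l" using l by (simp add: add_pos_nonneg)
    fix n
    define \<mu> where "\<mu> = Med (\<lambda>x. 1 - u n x)"
    have \<mu>: "u n \<mu> \<le> 1/2" "\<And>x. x < \<mu> \<Longrightarrow> 1/2 < u n x" unfolding \<mu>_def using tail_at_Med[OF u] by auto
    have "u n (A + \<mu>) \<le> u n (\<mu> + real j * l)" using l by (intro um) (simp add: A_def algebra_simps)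
    also have "\<dots> < \<delta>" using decay[of n \<mu> j] \<mu>(1) \<delta> j by linarith
    finally have right: "u n (A + \<mu>) < \<delta>" .
    have left: "1 - \<delta> < u n (- A + \<mu>)"
    proof (rule ccontr)
      assume "\<not> 1 - \<delta> < u n (- A + \<mu>)"
      then have "u n (- A + \<mu> + real j * l) < 1/2" using decay[of n "- A + \<mu>" j] j \<delta> by linarith
      moreover have eq: "- A + \<mu> + real j * l = \<mu> - l" by (simp add: A_def algebra_simps)
      ultimately have "u n (\<mu> - l) < 1/2" by (simp only: eq)
      moreover have "1/2 < u n (\<mu> - l)" using l by (intro \<mu>(2)) simp
      ultimately show False by linarith
    qed
    show "1 - \<epsilon> < 1 - u n ((real j + 1) * l + Med (\<lambda>x. 1 - u n x)) - (1 - u n (- ((real j + 1) * l) + Med (\<lambda>x. 1 - u n x)))"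
      using right left \<delta>(3) unfolding A_def \<mu>_def by linarith
  qed
qed

theorem theorem2p5:
  fixes m :: real
    and Q :: "nat \<Rightarrow> real \<Rightarrow> real"
    and G :: "nat \<Rightarrow> real \<Rightarrow> real \<Rightarrow> real"
    and T :: "nat \<Rightarrow> (real \<Rightarrow> real) \<Rightarrow> real \<Rightarrow> real"
    and F :: "nat \<Rightarrow> real \<Rightarrow> real"
  assumes Q_onto: "\<And>n. Q n ` {0..1} = {0..1}"
    and Q_nonlinear: "\<And>n. \<not> (\<exists>b c. \<forall>x\<in>{0..1}. Q n x = b * x + c)"
    and G_tail: "\<And>n y. G n y \<in> tail_functions"
    and A: "assumption_A m Q"
    and B: "assumption_B m G"
    and T_def: "\<And>n u x. u \<in> tail_functions \<Longrightarrow> T n u x = rec_op (Q n) (G n) u x"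
    and T_maps: "\<And>n u. u \<in> tail_functions \<Longrightarrow> T n u \<in> tail_functions"
    and C: "assumption_C T"
    and F_0: "\<And>x. F 0 x = (if x \<ge> 0 then 1 else 0)"
    and F_Suc: "\<And>n. (\<lambda>x. 1 - F (Suc n) x) = T n (\<lambda>x. 1 - F n x)"
  shows "tight_dfs (\<lambda>n x. F n (x + Med (F n)))"
proof -
  define u where "u = (\<lambda>n x. 1 - F n x)"
  have F: "F n = (\<lambda>x. 1 - u n x)" for n by (simp add: u_def)
  have u0: "u 0 = (\<lambda>x. if 0 \<le> x then 0 else 1)" by (auto simp: u_def F_0)
  have uT: "u (Suc n) = T n (u n)" for n using F_Suc[of n] by (simp add: u_def)
  have u: "u n \<in> tail_functions" for n
  proof (induction n)
    case 0
    have "((\<lambda>y. 1 - u 0 y) \<longlongrightarrow> 1 - u 0 x) (at_right x)" for x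
    proof (rule tendsto_eventually)
      show "eventually (\<lambda>y. 1 - u 0 y = 1 - u 0 x) (at_right x)"
        using eventually_at_right_less[of x] eventually_at_right_real[of x 0]
        by (cases "0 \<le> x") (auto simp: u0 elim: eventually_mono)
    qed
    moreover have "((\<lambda>y. 1 - u 0 y) \<longlongrightarrow> 0) at_bot"
      by (rule tendsto_eventually) (auto simp: u0 eventually_at_bot_linorder intro!: exI[of _ "-1"])
    moreover have "((\<lambda>y. 1 - u 0 y) \<longlongrightarrow> 1) at_top"
      by (rule tendsto_eventually) (auto simp: u0 eventually_at_top_linorder intro!: exI[of _ 0])
    ultimately show ?case
      by (auto simp: tail_functions_def distribution_function_def mono_def continuous_within u0)
  next
    case (Suc n)
    then show ?case unfolding uT by (rule T_maps)
  qed
  have uSuc: "u (Suc n) = rec_op (Q n) (G n) (u n)" for n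
    unfolding uT using T_def[OF u] by (intro ext)
  obtain \<epsilon> K \<beta> d where nf: "0 < \<epsilon>" "0 < K" "0 < \<beta>" "0 < d" "\<And>n. left_expanding \<epsilon> K \<beta> d (u n)"
    using left_expanding_along_recursion[OF Q_onto G_tail A B u u0 uSuc] by blast
  \<comment> \<open>Up to this level half of the expansion survives the error.\<close>
  define \<delta>1 where "\<delta>1 = (\<epsilon> / (2 * K)) powr (1 / \<beta>)"
  have \<delta>1: "0 < \<delta>1" "\<delta>1 powr \<beta> = \<epsilon> / (2 * K)" using nf by (auto simp: \<delta>1_def powr_powr)
  have base: "(1 + \<epsilon> / 2) * u n y \<le> u n (y - d)" if "u n y \<le> \<delta>1" for n y
  proof -
    have uy: "0 \<le> u n y" using tail_functionsD(2)[OF u] .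
    then have "u n y powr \<beta> \<le> \<epsilon> / (2 * K)"
      unfolding \<delta>1(2)[symmetric] using that nf by (intro powr_mono2) auto
    then have "K * u n y powr \<beta> \<le> \<epsilon> / 2" using nf by (simp add: field_simps)
    then have "K * u n y powr \<beta> * u n y \<le> \<epsilon> / 2 * u n y" using uy by (intro mult_right_mono)
    then show ?thesis using nf(5)[of n] by (auto simp: left_expanding_def algebra_simps dest!: spec[of _ y])
  qed
  obtain q where q: "q \<in> Q_tilde_class"
    and qC: "\<And>\<eta>. 0 < \<eta> \<Longrightarrow> \<exists>B\<ge>0. \<forall>n. \<forall>v\<in>tail_functions. \<forall>x.
        T n v x \<ge> q (v (x + B)) - \<eta> \<and> T n v x \<le> q (v (x - B)) + \<eta>"
    using C unfolding assumption_C_def by blast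
  have C': "\<exists>B\<ge>0. \<forall>n x. q (u n (x + B)) - \<eta> \<le> u (Suc n) x \<and> u (Suc n) x \<le> q (u n (x - B)) + \<eta>"
    if "0 < \<eta>" for \<eta>
    using qC[OF that] u unfolding uT by blast
  have "tight_dfs (\<lambda>n x. 1 - u n (x + Med (\<lambda>x. 1 - u n x)))"
  proof (rule tight_if_ratio_gap[OF u])
    fix \<delta> :: real assume \<delta>: "0 < \<delta>" "\<delta> < 1"
    have u01: "u 0 x \<in> {0, 1}" for x by (simp add: u0)
    have half: "0 < \<epsilon> / 2" using nf by simp
    show "\<exists>l>0. \<exists>\<epsilon>>0. \<forall>n a b. l \<le> b - a \<longrightarrow> u n a \<le> 1 - \<delta> \<longrightarrow> 0 < u n b \<longrightarrow> (1 + \<epsilon>) * u n b < u n a"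
      using ratio_gap[OF u u01 q C' base \<delta>1(1) half nf(4) \<delta>] by metis
  qed
  then show ?thesis by (simp add: F)
qed

end
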